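(* Let $t_0<t_f$ be real numbers, let $r<n$, $m$, $p$ be positive integers, and let $A:[t_0,t_f]\to\mathbb{R}^{n\times n}$, $B:[t_0,t_f]\to\mathbb{R}^{n\times m}$, $C:[t_0,t_f]\to\mathbb{R}^{p\times n}$ be continuous and bounded. For continuous and bounded $A_r:[t_0,t_f]\to\mathbb{R}^{r\times r}$, $B_r:[t_0,t_f]\to\mathbb{R}^{r\times m}$, $C_r:[t_0,t_f]\to\mathbb{R}^{p\times r}$ let $$J[A_r,B_r,C_r]=\int_{t_0}^{t_f}\int_{t_0}^{t}\left\Vert C(t)\phi(t,\tau)B(\tau)-C_r(t)\phi_r(t,\tau)B_r(\tau)\right\Vert_F^2\,d\tau\,dt ,$$ where $\phi$ and $\phi_r$ are the state transition matrices of $A$ and $A_r$. Let the continuous time-varying matrices $A_r^*(t)$, $B_r^*(t)$, $C_r^*(t)$ be a stationary point of the functional $J$. Let $P_r^*,Q_r^*:[t_0,t_f]\to\mathbb{R}^{r\times r}$ and $X^*,Y^*:[t_0,t_f]\to\mathbb{R}^{n\times r}$ be the solutions of $$\tfrac{d}{dt}P_r^*=A_r^*P_r^*+P_r^*(A_r^* )^{T}+B_r^*(B_r^* )^{T},\quad P_r^*(t_0)=0,$$ $$-\tfrac{d}{dt}Q_r^*=(A_r^* )^{T}Q_r^*+Q_r^*A_r^*+(C_r^* )^{T}C_r^*,\quad Q_r^*(t_f)=0,$$ $$\tfrac{d}{dt}X^*=AX^*+X^*(A_r^* )^{T}+B(B_r^* )^{T},\quad X^*(t_0)=0,$$ $$-\tfrac{d}{dt}Y^*=A^{T}Y^*+Y^*A_r^*+C^{T}C_r^*,\quad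 Y^*(t_f)=0.$$ If $P_r^*(t)$ and $Q_r^*(t)$ are invertible at every instant $t\in[t_0,t_f]$, then $$A_r^*(t)=W_r(t)^{T}\left(A(t)V_r(t)-\frac{dV_r(t)}{dt}\right),$$ or, equivalently, $$A_r^*(t)=\left(W_r(t)^{T}A(t)+\frac{d}{dt}W_r(t)^{T}\right)V_r(t),$$ and $$B_r^*(t)=W_r(t)^{T}B(t),\qquad C_r^*(t)=C(t)V_r(t),$$ where $W_r(t)^{T}V_r(t)=I_r$ with $W_r(t)=Y^*(t)\,(Q_r^*(t))^{-1}$ and $V_r(t)=X^*(t)\,(P_r^*(t))^{-1}$.
   Context: The state transition matrix $\phi$ of $A$ is the solution of $\frac{\partial}{\partial t}\phi(t,\tau)=A(t)\phi(t,\tau)$, $\phi(\tau,\tau)=I_n$, for $t,\tau\in[t_0,t_f]$; similarly $\phi_r$ for $A_r$ with $\phi_r(\tau,\tau)=I_r$. $\Vert\cdot\Vert_F$ is the Frobenius norm. $J$ is the square of the finite horizon $H_2$ error norm between the systems $\dot x=A(t)x+B(t)u$, $y=C(t)x$ and $\dot x_r=A_r(t)x_r+B_r(t)u$, $y_r=C_r(t)x_r$. A stationary point of $J$ is a triple $(A_r^*,B_r^*,C_r^* )$ of continuous matrix functions at which the directional derivatives of $J$ with respect to each of its three arguments vanish in every continuous direction, i.e. for all continuous $\Delta A_r:[t_0,t_f]\to\mathbb{R}^{r\times r}$, $\Delta B_r:[t_0,t_f]\to\mathbb{R}^{r\times m}$, $\Delta C_r:[t_0,t_f]\to\mathbb{R}^{p\times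 r}$, the limits as $\epsilon\to0$ of $\frac1\epsilon(J[A_r^*+\epsilon\Delta A_r,B_r^*,C_r^*]-J[A_r^*,B_r^*,C_r^*])$, $\frac1\epsilon(J[A_r^*,B_r^*+\epsilon\Delta B_r,C_r^*]-J[A_r^*,B_r^*,C_r^*])$ and $\frac1\epsilon(J[A_r^*,B_r^*,C_r^*+\epsilon\Delta C_r]-J[A_r^*,B_r^*,C_r^*])$ are all $0$. *)

theory Defs
  imports "HOL-Analysis.Analysis"
begin

text \<open>
  Matrix functions on the interval from t0 to tf are total functions on the reals of which only
  the values on \<open>{t0..tf}\<close> matter. Derivatives are taken within \<open>{t0..tf}\<close>,
  i.e. they are one-sided at the end points.
\<close>

definition is_state_transition ::
  "real \<Rightarrow> real \<Rightarrow> (real \<Rightarrow> real^'n^'n) \<Rightarrow> (real \<Rightarrow> real \<Rightarrow> real^'n^'n) \<Rightarrow> bool" where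
  "is_state_transition t0 tf A \<phi> \<longleftrightarrow>
     (\<forall>\<tau>\<in>{t0..tf}. \<phi> \<tau> \<tau> = mat 1 \<and>
        (\<forall>t\<in>{t0..tf}.
           ((\<lambda>s. \<phi> s \<tau>) has_vector_derivative (A t ** \<phi> t \<tau>)) (at t within {t0..tf})))"

text \<open>
  For continuous \<open>A\<close> the initial value problem has exactly one solution on
  \<open>{t0..tf} \<times> {t0..tf}\<close>; the choice operator leaves freedom only outside this square.
\<close>

definition state_transition ::
  "real \<Rightarrow> real \<Rightarrow> (real \<Rightarrow> real^'n^'n) \<Rightarrow> real \<Rightarrow> real \<Rightarrow> real^'n^'n" where
  "state_transition t0 tf A = (SOME \<phi>. is_state_transition t0 tf A \<phi>)"

text \<open>The norm of the type \<open>real^'n^'m\<close> is the Frobenius norm.\<close>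

lemma norm_matrix_eq_frobenius:
  fixes M :: "real^'n^'m"
  shows "norm M = sqrt (\<Sum>i\<in>UNIV. \<Sum>j\<in>UNIV. (M $ i $ j)\<^sup>2)"
  by (simp add: norm_vec_def L2_set_def sum_nonneg)

definition H2_error_sq ::
  "real \<Rightarrow> real \<Rightarrow>
   (real \<Rightarrow> real^'n^'n) \<Rightarrow> (real \<Rightarrow> real^'m^'n) \<Rightarrow> (real \<Rightarrow> real^'n^'p) \<Rightarrow>
   (real \<Rightarrow> real^'r^'r) \<Rightarrow> (real \<Rightarrow> real^'m^'r) \<Rightarrow> (real \<Rightarrow> real^'r^'p) \<Rightarrow> real" where
  "H2_error_sq t0 tf A B C Ar Br Cr =
     integral {t0..tf} (\<lambda>t. integral {t0..t} (\<lambda>\<tau>.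
       (norm (C t ** state_transition t0 tf A t \<tau> ** B \<tau>
              - Cr t ** state_transition t0 tf Ar t \<tau> ** Br \<tau>))\<^sup>2))"

definition H2_stationary ::
  "real \<Rightarrow> real \<Rightarrow>
   (real \<Rightarrow> real^'n^'n) \<Rightarrow> (real \<Rightarrow> real^'m^'n) \<Rightarrow> (real \<Rightarrow> real^'n^'p) \<Rightarrow>
   (real \<Rightarrow> real^'r^'r) \<Rightarrow> (real \<Rightarrow> real^'m^'r) \<Rightarrow> (real \<Rightarrow> real^'r^'p) \<Rightarrow> bool" where
  "H2_stationary t0 tf A B C Ar Br Cr \<longleftrightarrow>
     continuous_on {t0..tf} Ar \<and> continuous_on {t0..tf} Br \<and> continuous_on {t0..tf} Cr \<and>
     (\<forall>D :: real \<Rightarrow> real^'r^'r. continuous_on {t0..tf} D \<longrightarrow>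
        ((\<lambda>\<epsilon>. (H2_error_sq t0 tf A B C (\<lambda>t. Ar t + \<epsilon> *\<^sub>R D t) Br Cr
               - H2_error_sq t0 tf A B C Ar Br Cr) / \<epsilon>) \<longlongrightarrow> 0) (at 0)) \<and>
     (\<forall>D :: real \<Rightarrow> real^'m^'r. continuous_on {t0..tf} D \<longrightarrow>
        ((\<lambda>\<epsilon>. (H2_error_sq t0 tf A B C Ar (\<lambda>t. Br t + \<epsilon> *\<^sub>R D t) Cr
               - H2_error_sq t0 tf A B C Ar Br Cr) / \<epsilon>) \<longlongrightarrow> 0) (at 0)) \<and>
     (\<forall>D :: real \<Rightarrow> real^'r^'p. continuous_on {t0..tf} D \<longrightarrow>
        ((\<lambda>\<epsilon>. (H2_error_sq t0 tf A B C Ar Br (\<lambda>t. Cr t + \<epsilon> *\<^sub>R D t)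
               - H2_error_sq t0 tf A B C Ar Br Cr) / \<epsilon>) \<longlongrightarrow> 0) (at 0))"

end

(*
  With X, Y, P_r, Q_r the solutions of the Sylvester equations of the statement (and P_A the one for
  the full model), the error functional becomes
    J = integral of <C^T C, P_A> - 2 <C^T C_r, X> + <C_r^T C_r, P_r>.
  A change of A_r or B_r changes X and P_r by solutions of the same Sylvester equations with new
  right-hand sides; pairing these with the adjoint solutions Y and Q_r turns J - J* into an exact
  integral formula, so neither Fubini nor a derivative of the transition matrix with respect to
  A_r is needed.  Stationarity then reads
    Q_r P_r = Y^T X,   Q_r B_r = Y^T B,   C_r P_r = C X,
  and the claim follows by differentiating X P_r^(-1) and Y Q_r^(-1).
*)
theory Submission
  imports Defs
begin

text \<open>The gramians depend nonlinearly on A_r, yet no expansion in epsilon is made: the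
  difference of the perturbed and the unperturbed gramian solves the unperturbed equation exactly,
  with the perturbed gramian moved into the forcing term. For B_r the resulting integrand is a
  polynomial in epsilon. For A_r it still contains the perturbed gramians, and their uniform
  convergence, a Gronwall estimate, is all that the limit requires. The gradients found in this way
  are continuous, so each of them is itself an admissible direction. The three stationarity
  relations hold at every instant. Inverses enter only at the end and only pointwise, because
  P_r(t0) = 0 and Q_r(tf) = 0 rule out invertibility at the two end points. Transition matrices are
  values of a choice operator; they become usable through a factorization Phi(t) Psi(tau) in which
  Psi is the inverse of Phi, obtained from the adjoint equation.\<close>

subsection \<open>Linear differential equations\<close>

text \<open>Picard iteration for an abstract linear operator on a Banach space, so that one result
  serves left multiplication, right multiplication and the two-sided Sylvester operator.\<close>

lemma linear_ivp_exists:
  fixes f :: "real \<Rightarrow> 'a::banach \<Rightarrow> 'a"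
  assumes "a \<le> b"
    and cont: "\<And>x. continuous_on {a..b} x \<Longrightarrow> continuous_on {a..b} (\<lambda>t. f t (x t))"
    and lin: "\<And>t. linear (f t)"
    and bound: "\<And>t x. t \<in> {a..b} \<Longrightarrow> norm (f t x) \<le> M * norm x"
    and g: "continuous_on {a..b} g"
  obtains x where "x a = x0"
    "\<And>t. t \<in> {a..b} \<Longrightarrow> (x has_vector_derivative f t (x t) + g t) (at t within {a..b})"
proof -
  define K where "K = max M 0"
  have bK: "norm (f t x) \<le> K * norm x" if "t \<in> {a..b}" for t x
    using bound[OF that, of x] unfolding K_def
    by (smt (verit) max_def mult_right_mono norm_ge_zero)
  have K0: "0 \<le> K" by (simp add: K_def)
  define T where "T = (\<lambda>x t. x0 + integral {a..t} (\<lambda>s. f s (x s) + g s))"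
  define S where "S = (\<lambda>n. (T ^^ n) (\<lambda>_. x0))"
  have S0: "S 0 = (\<lambda>_. x0)" and SS: "S (Suc n) = T (S n)" for n by (simp_all add: S_def)
  have rhs: "continuous_on {a..b} (\<lambda>s. f s (x s) + g s)" if "continuous_on {a..b} x" for x
    by (intro continuous_intros cont g that)
  have Tder: "(T x has_vector_derivative f t (x t) + g t) (at t within {a..b})"
    if "continuous_on {a..b} x" "t \<in> {a..b}" for x t
    unfolding T_def using integral_has_vector_derivative[OF rhs[OF that(1)] that(2)]
    by (auto intro!: derivative_eq_intros)
  have Tcont: "continuous_on {a..b} (T x)" if "continuous_on {a..b} x" for x
    unfolding continuous_on_eq_continuous_within
    using Tder[OF that] has_vector_derivative_continuous by blast
  have Scont: "continuous_on {a..b} (S n)" for n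
    by (induction n) (auto simp: S0 SS intro: Tcont)
  define d where "d = (\<lambda>n t. S (Suc n) t - S n t)"
  have dcont: "continuous_on {a..b} (d n)" for n
    unfolding d_def by (intro continuous_intros Scont)
  \<comment> \<open>The source \<open>g\<close> cancels between consecutive iterates, so the
    increments follow the homogeneous equation.\<close>
  have dSuc: "d (Suc n) t = integral {a..t} (\<lambda>s. f s (d n s))" if "t \<in> {a..b}" for n t
  proof -
    have i: "(\<lambda>s. f s (S k s) + g s) integrable_on {a..t}" for k
      by (rule integrable_continuous_real, rule continuous_on_subset[OF rhs[OF Scont]]) (use that in auto)
    show ?thesis
      unfolding d_def SS T_def
      using integral_diff[OF i[of "Suc n"] i[of n]] by (simp add: linear_diff[OF lin] SS T_def)
  qed
  obtain N where N: "\<And>t. t \<in> {a..b} \<Longrightarrow> norm (d 0 t) \<le> N"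
    using compact_imp_bounded[OF compact_continuous_image[OF dcont[of 0] compact_Icc]]
    unfolding bounded_iff by blast
  have N0: "0 \<le> N" using N[of a] \<open>a \<le> b\<close> norm_ge_zero order_trans by (metis atLeastAtMost_iff order_refl)
  \<comment> \<open>With the weight exp (2 K (t - a)) each Picard step contracts by the factor 1/2.\<close>
  have dbound: "norm (d n t) \<le> N * (1/2)^n * exp (2*K*(t-a))" if "t \<in> {a..b}" for n t
    using that
  proof (induction n arbitrary: t)
    case 0
    have "norm (d 0 t) \<le> N * 1" using N 0 by simp
    also have "\<dots> \<le> N * exp (2*K*(t-a))"
      using 0 K0 N0 by (intro mult_left_mono) auto
    finally show ?case by simp
  next
    case (Suc n)
    have i: "(\<lambda>s. f s (d n s)) integrable_on {a..t}"
      by (rule integrable_continuous_real, rule continuous_on_subset[OF cont[OF dcont]]) (use Suc in auto)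
    have e: "((\<lambda>s. K * (N * (1/2)^n * exp (2*K*(s-a)))) has_integral
        N * (1/2)^Suc n * exp (2*K*(t-a)) - N * (1/2)^Suc n * exp (2*K*(a-a))) {a..t}"
      by (rule fundamental_theorem_of_calculus)
        (use Suc in \<open>auto intro!: derivative_eq_intros simp: has_real_derivative_iff_has_vector_derivative[symmetric] field_simps\<close>)
    have "norm (d (Suc n) t) \<le> integral {a..t} (\<lambda>s. K * (N * (1/2)^n * exp (2*K*(s-a))))"
      unfolding dSuc[OF Suc.prems]
    proof (rule integral_norm_bound_integral[OF i])
      show "(\<lambda>s. K * (N * (1/2)^n * exp (2*K*(s-a)))) integrable_on {a..t}" using e by blast
      fix s assume s: "s \<in> {a..t}"
      then have s': "s \<in> {a..b}" using Suc.prems by auto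
      show "norm (f s (d n s)) \<le> K * (N * (1/2)^n * exp (2*K*(s-a)))"
        using bK[OF s', of "d n s"] Suc.IH[OF s'] K0 by (meson mult_left_mono order_trans)
    qed
    also have "\<dots> \<le> N * (1/2)^Suc n * exp (2*K*(t-a))"
      using integral_unique[OF e] N0 by simp
    finally show ?case .
  qed
  have "uniform_limit {a..b} (\<lambda>n t. \<Sum>i<n. d i t) (\<lambda>t. \<Sum>i. d i t) sequentially"
  proof (rule Weierstrass_m_test)
    show "summable (\<lambda>n. N * (1/2)^n * exp (2*K*(b-a)))"
      by (intro summable_mult summable_mult2 summable_geometric) auto
    fix n t assume t: "t \<in> {a..b}"
    have "2*K*(t-a) \<le> 2*K*(b-a)" using t K0 by (intro mult_left_mono) auto
    then show "norm (d n t) \<le> N * (1/2)^n * exp (2*K*(b-a))"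
      by (intro order_trans[OF dbound[OF t]] mult_left_mono) (use N0 in auto)
  qed
  then have "uniform_limit {a..b} (\<lambda>n t. x0 + (\<Sum>i<n. d i t)) (\<lambda>t. x0 + (\<Sum>i. d i t)) sequentially"
    by (intro uniform_limit_intros)
  moreover have "x0 + (\<Sum>i<n. d i t) = S n t" for n t
    by (induction n) (auto simp: S0 d_def algebra_simps)
  ultimately obtain x where x: "uniform_limit {a..b} S x sequentially"
    by (auto simp: fun_eq_iff)
  have xcont: "continuous_on {a..b} x"
    by (rule uniform_limit_theorem[OF _ x]) (auto simp: Scont)
  have fx: "uniform_limit {a..b} (\<lambda>n s. f s (S n s) + g s) (\<lambda>s. f s (x s) + g s) sequentially"
  proof (rule uniform_limitI)
    fix e :: real assume "e > 0"
    then have "\<forall>\<^sub>F n in sequentially. \<forall>s\<in>{a..b}. dist (S n s) (x s) < e / (K + 1)"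
      using K0 by (intro uniform_limitD[OF x]) auto
    then show "\<forall>\<^sub>F n in sequentially. \<forall>s\<in>{a..b}. dist (f s (S n s) + g s) (f s (x s) + g s) < e"
    proof (eventually_elim, intro ballI)
      fix n s assume h: "\<forall>s\<in>{a..b}. dist (S n s) (x s) < e / (K + 1)" and s: "s \<in> {a..b}"
      have "dist (f s (S n s) + g s) (f s (x s) + g s) = norm (f s (S n s - x s))"
        by (simp add: dist_norm linear_diff[OF lin])
      also have "\<dots> \<le> K * norm (S n s - x s)" by (rule bK[OF s])
      also have "\<dots> \<le> K * (e / (K+1))" using h s K0 by (intro mult_left_mono) (auto simp: dist_norm less_imp_le)
      also have "\<dots> < e" using K0 \<open>e > 0\<close> by (simp add: field_simps)
      finally show "dist (f s (S n s) + g s) (f s (x s) + g s) < e" .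
    qed
  qed
  \<comment> \<open>Passing to the limit in \<open>S (Suc n) t = T (S n) t\<close>, with the
    integral handled by the uniform convergence \<open>fx\<close>.\<close>
  have xT: "x t = T x t" if t: "t \<in> {a..b}" for t
  proof -
    have fx': "uniform_limit {a..t} (\<lambda>n s. f s (S n s) + g s) (\<lambda>s. f s (x s) + g s) sequentially"
      by (rule uniform_limit_on_subset[OF fx]) (use t in auto)
    have c: "continuous_on {a..t} (\<lambda>s. f s (S n s) + g s)" for n
      by (rule continuous_on_subset[OF rhs[OF Scont]]) (use t in auto)
    obtain I J where I: "\<And>n. ((\<lambda>s. f s (S n s) + g s) has_integral I n) {a..t}"
      and J: "((\<lambda>s. f s (x s) + g s) has_integral J) {a..t}" and IJ: "I \<longlonglongrightarrow> J"
      using uniform_limit_integral[OF fx' c] by (metis sequentially_bot)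
    have "(\<lambda>n. S (Suc n) t) \<longlonglongrightarrow> T x t"
      unfolding SS T_def using IJ integral_unique[OF I] integral_unique[OF J]
      by (auto intro!: tendsto_intros)
    moreover have "(\<lambda>n. S (Suc n) t) \<longlonglongrightarrow> x t"
      using tendsto_uniform_limitI[OF x t] LIMSEQ_Suc by blast
    ultimately show ?thesis using LIMSEQ_unique by blast
  qed
  show ?thesis
  proof
    show "x a = x0" using xT[of a] \<open>a \<le> b\<close> by (simp add: T_def)
    show "(x has_vector_derivative f t (x t) + g t) (at t within {a..b})" if t: "t \<in> {a..b}" for t
      by (rule has_vector_derivative_transform[OF t _ Tder[OF xcont t]]) (use xT in auto)
  qed
qed

text \<open>The squared norm is estimated because it stays differentiable where \<open>x\<close>
  vanishes. The extra 1 in the rate \<open>2*K + 1\<close> pays for 2 |x| c \<le> |x|^2 +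
  c^2.\<close>

lemma gronwall_zero_initial:
  fixes x :: "real \<Rightarrow> 'a::euclidean_space"
  assumes x: "\<And>t. t \<in> {a..b} \<Longrightarrow> (x has_vector_derivative x' t) (at t within {a..b})"
    and "x a = 0"
    and bound: "\<And>t. t \<in> {a..b} \<Longrightarrow> norm (x' t) \<le> K * norm (x t) + c"
    and "0 \<le> K" "t \<in> {a..b}"
  shows "(norm (x t))\<^sup>2 \<le> c\<^sup>2 * (t - a) * exp ((2*K + 1) * (t - a))"
proof -
  define L where "L = 2*K + 1"
  \<comment> \<open>The integrating factor removes the growth of rate \<open>L\<close>, and
    subtracting \<open>c\<^sup>2 * (s - a)\<close> absorbs the inhomogeneity, so that
    \<open>h\<close> cannot increase.\<close>
  define h where "h = (\<lambda>s. (x s \<bullet> x s) * exp (- L * (s - a)) - c\<^sup>2 * (s - a))"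
  define h' where "h' = (\<lambda>s. (2 * (x s \<bullet> x' s) - L * (x s \<bullet> x s)) * exp (- L * (s - a)) - c\<^sup>2)"
  have "(h' has_integral (h t - h a)) {a..t}"
  proof (rule fundamental_theorem_of_calculus)
    fix s assume s: "s \<in> {a..t}"
    then have "(x has_vector_derivative x' s) (at s within {a..t})"
      using assms by (intro has_vector_derivative_within_subset[OF x]) auto
    then have "((\<lambda>s. x s \<bullet> x s) has_vector_derivative x s \<bullet> x' s + x' s \<bullet> x s) (at s within {a..t})"
      by (intro bounded_bilinear.has_vector_derivative[OF bounded_bilinear_inner])
    then show "(h has_vector_derivative h' s) (at s within {a..t})"
      unfolding h_def h'_def has_real_derivative_iff_has_vector_derivative[symmetric]
      by (auto intro!: derivative_eq_intros simp: algebra_simps inner_commute)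
  qed (use assms in auto)
  moreover have "h' s \<le> 0" if s: "s \<in> {a..t}" for s
  proof -
    have s': "s \<in> {a..b}" using s assms by auto
    have "2 * (x s \<bullet> x' s) \<le> 2 * (norm (x s) * (K * norm (x s) + c))"
      using Cauchy_Schwarz_ineq2[of "x s" "x' s"] mult_left_mono[OF bound[OF s'], of "norm (x s)"]
      by (simp add: abs_le_iff)
    also have "\<dots> = 2 * K * (norm (x s))\<^sup>2 + 2 * norm (x s) * c" by (simp add: algebra_simps power2_eq_square)
    also have "\<dots> \<le> L * (norm (x s))\<^sup>2 + c\<^sup>2"
      using sum_squares_bound[of "norm (x s)" c] by (simp add: L_def algebra_simps)
    finally have "2 * (x s \<bullet> x' s) - L * (x s \<bullet> x s) \<le> c\<^sup>2" by (simp add: dot_square_norm)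
    then have "(2 * (x s \<bullet> x' s) - L * (x s \<bullet> x s)) * exp (- L * (s - a)) \<le> c\<^sup>2 * exp (- L * (s - a))"
      by (intro mult_right_mono) auto
    also have "\<dots> \<le> c\<^sup>2 * 1"
      using s \<open>0 \<le> K\<close> by (intro mult_left_mono) (auto simp: L_def mult_nonpos_nonneg)
    finally show ?thesis by (simp add: h'_def)
  qed
  ultimately have "h t - h a \<le> 0"
    using has_integral_le[OF _ has_integral_0] by blast
  then have "(x t \<bullet> x t) * exp (- L * (t - a)) \<le> c\<^sup>2 * (t - a)"
    using \<open>x a = 0\<close> by (simp add: h_def)
  then have "(x t \<bullet> x t) * exp (- L * (t - a)) * exp (L * (t - a)) \<le> c\<^sup>2 * (t - a) * exp (L * (t - a))"
    by (intro mult_right_mono) auto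
  moreover have "exp (- L * (t - a)) * exp (L * (t - a)) = 1" by (simp flip: exp_add)
  ultimately show ?thesis by (simp only: L_def dot_square_norm mult.assoc mult_1_right)
qed

subsection \<open>Matrix calculus and state transition matrices\<close>

lemma bounded_bilinear_matrix_mul:
  "bounded_bilinear ((**) :: real^'k^'n \<Rightarrow> real^'m^'k \<Rightarrow> real^'m^'n)"
  unfolding bilinear_conv_bounded_bilinear[symmetric] bilinear_def
  by (auto intro!: linearI simp: vec_eq_iff matrix_matrix_mult_def algebra_simps
      sum.distrib sum_distrib_left)

interpretation mm: bounded_bilinear
  "(**) :: real^'k^'n \<Rightarrow> real^'m^'k \<Rightarrow> real^'m^'n"
  by (rule bounded_bilinear_matrix_mul)

lemma bounded_linear_transpose:
  "bounded_linear (transpose :: real^'m^'n \<Rightarrow> real^'n^'m)"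
  unfolding linear_conv_bounded_linear[symmetric]
  by (intro linearI) (auto simp: vec_eq_iff transpose_def)

lemmas transpose_add = linear_add[OF bounded_linear.linear[OF bounded_linear_transpose]]
  and transpose_diff = linear_diff[OF bounded_linear.linear[OF bounded_linear_transpose]]
  and transpose_minus = linear_neg[OF bounded_linear.linear[OF bounded_linear_transpose]]
  and transpose_0 = linear_0[OF bounded_linear.linear[OF bounded_linear_transpose]]

lemmas continuous_on_transpose [continuous_intros] =
  bounded_linear.continuous_on[OF bounded_linear_transpose]
lemmas continuous_on_matrix_mul [continuous_intros] = mm.continuous_on

section \<open>Adjoints of matrix multiplication for the Frobenius inner product\<close>

lemma inner_matrix_mul_left:
  fixes M :: "real^'k^'n" and N :: "real^'m^'k" and R :: "real^'m^'n"
  shows "(M ** N) \<bullet> R = N \<bullet> (transpose M ** R)"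
proof -
  have "(M ** N) \<bullet> R = (\<Sum>i\<in>UNIV. \<Sum>j\<in>UNIV. \<Sum>k\<in>UNIV. M$i$k * N$k$j * R$i$j)"
    by (simp add: inner_vec_def matrix_matrix_mult_def sum_distrib_right)
  also have "\<dots> = (\<Sum>i\<in>UNIV. \<Sum>k\<in>UNIV. \<Sum>j\<in>UNIV. M$i$k * N$k$j * R$i$j)"
    by (rule sum.cong[OF refl], rule sum.swap)
  also have "\<dots> = (\<Sum>k\<in>UNIV. \<Sum>i\<in>UNIV. \<Sum>j\<in>UNIV. M$i$k * N$k$j * R$i$j)"
    by (rule sum.swap)
  also have "\<dots> = (\<Sum>k\<in>UNIV. \<Sum>j\<in>UNIV. \<Sum>i\<in>UNIV. M$i$k * N$k$j * R$i$j)"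
    by (rule sum.cong[OF refl], rule sum.swap)
  also have "\<dots> = N \<bullet> (transpose M ** R)"
    by (simp add: inner_vec_def matrix_matrix_mult_def transpose_def sum_distrib_left algebra_simps)
  finally show ?thesis .
qed

lemma inner_transpose:
  fixes M N :: "real^'m^'n"
  shows "transpose M \<bullet> transpose N = M \<bullet> N"
  by (simp add: inner_vec_def transpose_def) (rule sum.swap)

lemma inner_matrix_mul_right:
  fixes M :: "real^'k^'n" and N :: "real^'m^'k" and R :: "real^'m^'n"
  shows "(M ** N) \<bullet> R = M \<bullet> (R ** transpose N)"
  using inner_matrix_mul_left[of "transpose N" "transpose M" "transpose R"]
    inner_transpose[of "M ** N" R] inner_transpose[of M "R ** transpose N"]
  by (simp add: matrix_transpose_mul)

text \<open>Together with \<open>inner_matrix_mul_transpose\<close> this isolates a direction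
  \<open>D\<close> as the left factor of a pairing; what remains on the right is the
  gradient.\<close>

lemma inner_matrix_mul_mid:
  fixes D :: "real^'k^'n" and M :: "real^'m^'k" and N :: "real^'m^'n"
  shows "N \<bullet> (D ** M) = D \<bullet> (N ** transpose M)"
  by (metis inner_commute inner_matrix_mul_right)

lemma inner_matrix_mul_transpose:
  fixes D :: "real^'k^'m" and M :: "real^'k^'n" and N :: "real^'m^'n"
  shows "N \<bullet> (M ** transpose D) = D \<bullet> (transpose N ** M)"
  using inner_matrix_mul_mid[of "transpose N" D "transpose M"] inner_transpose[of N "M ** transpose D"]
  by (simp add: matrix_transpose_mul)

lemma has_vector_derivative_transpose:
  assumes "(F has_vector_derivative F') net"
  shows "((\<lambda>s. transpose (F s)) has_vector_derivative transpose (F' :: real^'m^'n)) net"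
  by (rule bounded_linear.has_vector_derivative[OF bounded_linear_transpose assms])

lemma constant_of_zero_vector_derivative:
  assumes "\<And>t. t \<in> {a..b} \<Longrightarrow> (F has_vector_derivative 0) (at t within {a..b})"
    and "s \<in> {a..b}" "t \<in> {a..b}"
  shows "F s = F t"
  by (rule has_derivative_zero_unique[of "{a..b}"])
    (use assms in \<open>auto simp: has_vector_derivative_def\<close>)

text \<open>The inverse is not extracted from \<open>\<Phi>\<close> but solved for: with
  \<open>\<Psi>\<close> from the adjoint equation the product of \<open>\<Psi>\<close> and
  \<open>\<Phi>\<close> has derivative zero, hence stays the identity. In finite dimension this left
  inverse is also a right inverse.\<close>

lemma fundamental_matrix_exists:
  fixes A :: "real \<Rightarrow> real^'n^'n"
  assumes "a \<le> b" "continuous_on {a..b} A"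
  obtains \<Phi> \<Psi> :: "real \<Rightarrow> real^'n^'n" where
    "\<And>t. t \<in> {a..b} \<Longrightarrow> (\<Phi> has_vector_derivative A t ** \<Phi> t) (at t within {a..b})"
    "\<And>t. t \<in> {a..b} \<Longrightarrow> (\<Psi> has_vector_derivative - (\<Psi> t ** A t)) (at t within {a..b})"
    "\<And>t. t \<in> {a..b} \<Longrightarrow> \<Phi> t ** \<Psi> t = mat 1"
    "\<And>t. t \<in> {a..b} \<Longrightarrow> \<Psi> t ** \<Phi> t = mat 1"
proof -
  obtain K where K: "\<And>M N. norm ((M::real^'n^'n) ** (N::real^'n^'n)) \<le> norm M * norm N * K" "K \<ge> 0"
    using mm.nonneg_bounded by blast
  obtain c where c: "\<And>t. t \<in> {a..b} \<Longrightarrow> norm (A t) \<le> c"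
    using compact_imp_bounded[OF compact_continuous_image[OF assms(2) compact_Icc]]
    unfolding bounded_iff by blast
  have cK: "norm (A t) * norm N * K \<le> c * K * norm N" if "t \<in> {a..b}" for t and N :: "real^'n^'n"
    using mult_right_mono[OF c[OF that], of "K * norm N"] K(2) by (simp add: mult_ac)
  obtain \<Phi> where \<Phi>: "\<Phi> a = mat 1"
    "\<And>t. t \<in> {a..b} \<Longrightarrow> (\<Phi> has_vector_derivative A t ** \<Phi> t + 0) (at t within {a..b})"
  proof (rule linear_ivp_exists[of a b "\<lambda>t M. A t ** M" "c * K" "\<lambda>t. 0" "mat 1"])
    show "norm (A t ** M) \<le> c * K * norm M" if "t \<in> {a..b}" for t and M :: "real^'n^'n"
      using order_trans[OF K(1) cK[OF that]] .
  qed (auto intro!: continuous_intros assms bounded_linear.linear mm.bounded_linear_right)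
  obtain \<Psi> where \<Psi>: "\<Psi> a = mat 1"
    "\<And>t. t \<in> {a..b} \<Longrightarrow> (\<Psi> has_vector_derivative - (\<Psi> t ** A t) + 0) (at t within {a..b})"
  proof (rule linear_ivp_exists[of a b "\<lambda>t M. - (M ** A t)" "c * K" "\<lambda>t. 0" "mat 1"])
    show "norm (- (M ** A t)) \<le> c * K * norm M" if "t \<in> {a..b}" for t and M :: "real^'n^'n"
      using order_trans[OF K(1) cK[OF that, of M, unfolded mult.commute[of "norm (A t)"]]] by simp
  qed (auto intro!: continuous_intros assms bounded_linear.linear bounded_linear_minus mm.bounded_linear_left)
  have one: "\<Psi> t ** \<Phi> t = mat 1" if t: "t \<in> {a..b}" for t
  proof -
    have "\<Psi> t ** \<Phi> t = \<Psi> a ** \<Phi> a"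
    proof (rule constant_of_zero_vector_derivative[OF _ t])
      fix s assume s: "s \<in> {a..b}"
      show "((\<lambda>t. \<Psi> t ** \<Phi> t) has_vector_derivative 0) (at s within {a..b})"
        using mm.has_vector_derivative[OF \<Psi>(2)[OF s] \<Phi>(2)[OF s]]
        by (simp add: mm.minus_left matrix_mul_assoc)
    qed (use assms in auto)
    then show ?thesis using \<Phi>(1) \<Psi>(1) by simp
  qed
  show ?thesis
  proof
    show "\<Phi> t ** \<Psi> t = mat 1" if "t \<in> {a..b}" for t
      by (rule matrix_left_right_inverse[THEN iffD1, OF one[OF that]])
  qed (use \<Phi>(2) \<Psi>(2) one in auto)
qed

text \<open>The product of \<open>\<Phi>\<close> and \<open>\<Psi>\<close> is a witness for the
  choice in \<open>state_transition\<close>. Conversely \<open>\<Psi>\<close> is an integrating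
  factor for every solution, which determines the chosen one on the whole square. Separating the two
  times leaves only \<open>\<Psi>\<close> to be differentiated when integrating over
  \<open>\<tau>\<close>.\<close>

lemma state_transition_factorization:
  fixes A :: "real \<Rightarrow> real^'n^'n"
  assumes "a \<le> b" "continuous_on {a..b} A"
  obtains \<Phi> \<Psi> :: "real \<Rightarrow> real^'n^'n" where
    "\<And>t \<tau>. t \<in> {a..b} \<Longrightarrow> \<tau> \<in> {a..b} \<Longrightarrow> state_transition a b A t \<tau> = \<Phi> t ** \<Psi> \<tau>"
    "\<And>t. t \<in> {a..b} \<Longrightarrow> (\<Psi> has_vector_derivative - (\<Psi> t ** A t)) (at t within {a..b})"
    "\<And>t. t \<in> {a..b} \<Longrightarrow> \<Phi> t ** \<Psi> t = mat 1"
proof -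
  obtain \<Phi> \<Psi> :: "real \<Rightarrow> real^'n^'n" where
    \<Phi>: "\<And>t. t \<in> {a..b} \<Longrightarrow> (\<Phi> has_vector_derivative A t ** \<Phi> t) (at t within {a..b})" and
    \<Psi>: "\<And>t. t \<in> {a..b} \<Longrightarrow> (\<Psi> has_vector_derivative - (\<Psi> t ** A t)) (at t within {a..b})" and
    inv: "\<And>t. t \<in> {a..b} \<Longrightarrow> \<Phi> t ** \<Psi> t = mat 1" "\<And>t. t \<in> {a..b} \<Longrightarrow> \<Psi> t ** \<Phi> t = mat 1"
    by (rule fundamental_matrix_exists[OF assms]) (rule that)
  let ?\<phi> = "state_transition a b A"
  have "is_state_transition a b A (\<lambda>t \<tau>. \<Phi> t ** \<Psi> \<tau>)"
    unfolding is_state_transition_def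
    using inv(1)
    by (auto simp: matrix_mul_assoc
        intro!: bounded_linear.has_vector_derivative[OF mm.bounded_linear_left \<Phi>])
  then have st: "is_state_transition a b A ?\<phi>"
    unfolding state_transition_def by (rule someI[of "is_state_transition a b A"])
  have "?\<phi> t \<tau> = \<Phi> t ** \<Psi> \<tau>" if t: "t \<in> {a..b}" "\<tau> \<in> {a..b}" for t \<tau>
  proof -
    have "\<Psi> t ** ?\<phi> t \<tau> = \<Psi> \<tau> ** ?\<phi> \<tau> \<tau>"
    proof (rule constant_of_zero_vector_derivative[OF _ t])
      fix s assume s: "s \<in> {a..b}"
      then have "((\<lambda>s. ?\<phi> s \<tau>) has_vector_derivative A s ** ?\<phi> s \<tau>) (at s within {a..b})"
        using st t unfolding is_state_transition_def by blast
      from mm.has_vector_derivative[OF \<Psi>[OF s] this]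
      show "((\<lambda>t. \<Psi> t ** ?\<phi> t \<tau>) has_vector_derivative 0) (at s within {a..b})"
        by (simp add: mm.minus_left matrix_mul_assoc)
    qed
    also have "?\<phi> \<tau> \<tau> = mat 1" using st t unfolding is_state_transition_def by blast
    finally have "\<Phi> t ** (\<Psi> t ** ?\<phi> t \<tau>) = \<Phi> t ** \<Psi> \<tau>" by simp
    then show ?thesis using inv(1)[OF t(1)] by (simp add: matrix_mul_assoc)
  qed
  then show ?thesis by (rule that[OF _ \<Psi> inv(1)])
qed

subsection \<open>Gramians\<close>

text \<open>One two-sided Sylvester problem covers all forward equations: \<open>P\<close> has both
  coefficients \<open>A\<close>, \<open>Pr\<close> has both \<open>Ar\<close>, and the rectangular
  \<open>X\<close> has \<open>A\<close> on the left and \<open>Ar\<close> on the right.\<close>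

definition gramian ::
  "real \<Rightarrow> real \<Rightarrow> (real \<Rightarrow> real^'n^'n) \<Rightarrow> (real \<Rightarrow> real^'k^'k) \<Rightarrow>
   (real \<Rightarrow> real^'k^'n) \<Rightarrow> (real \<Rightarrow> real^'k^'n) \<Rightarrow> bool" where
  "gramian a b A1 A2 F K \<longleftrightarrow> K a = 0 \<and>
     (\<forall>t\<in>{a..b}. (K has_vector_derivative A1 t ** K t + K t ** transpose (A2 t) + F t)
        (at t within {a..b}))"

text \<open>The adjoint of the \<open>gramian\<close> equation, with its condition at the other end
  of the interval; \<open>Qr\<close> and \<open>Y\<close> are of this kind.\<close>

definition cogramian ::
  "real \<Rightarrow> real \<Rightarrow> (real \<Rightarrow> real^'n^'n) \<Rightarrow> (real \<Rightarrow> real^'k^'k) \<Rightarrow>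
   (real \<Rightarrow> real^'k^'n) \<Rightarrow> (real \<Rightarrow> real^'k^'n) \<Rightarrow> bool" where
  "cogramian a b A1 A2 H L \<longleftrightarrow> L b = 0 \<and>
     (\<forall>t\<in>{a..b}. (L has_vector_derivative - (transpose (A1 t) ** L t + L t ** A2 t + H t))
        (at t within {a..b}))"

lemma continuous_on_of_vector_derivative:
  "(\<And>t. t \<in> S \<Longrightarrow> (F has_vector_derivative F' t) (at t within S)) \<Longrightarrow> continuous_on S F"
  unfolding continuous_on_eq_continuous_within
  using has_vector_derivative_continuous by blast

lemma gramianD:
  assumes "gramian a b A1 A2 F K"
  shows "K a = 0"
    and "t \<in> {a..b} \<Longrightarrow>
      (K has_vector_derivative A1 t ** K t + K t ** transpose (A2 t) + F t) (at t within {a..b})"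
  using assms unfolding gramian_def by auto

lemma cogramianD:
  assumes "cogramian a b A1 A2 H L"
  shows "L b = 0"
    and "t \<in> {a..b} \<Longrightarrow>
      (L has_vector_derivative - (transpose (A1 t) ** L t + L t ** A2 t + H t)) (at t within {a..b})"
  using assms unfolding cogramian_def by auto

lemma gramian_continuous: "gramian a b A1 A2 F K \<Longrightarrow> continuous_on {a..b} K"
  by (rule continuous_on_of_vector_derivative) (rule gramianD(2))

lemma cogramian_continuous: "cogramian a b A1 A2 H L \<Longrightarrow> continuous_on {a..b} L"
  by (rule continuous_on_of_vector_derivative) (rule cogramianD(2))

lemma norm_transpose: "norm (transpose (M :: real^'m^'n)) = norm M"
  by (simp add: norm_eq_sqrt_inner inner_transpose)

lemma continuous_on_Icc_norm_bound:
  assumes "continuous_on {a..b} (F :: real \<Rightarrow> 'a::real_normed_vector)"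
  obtains c where "0 \<le> c" "\<And>t. t \<in> {a..b} \<Longrightarrow> norm (F t) \<le> c"
proof -
  from compact_imp_bounded[OF compact_continuous_image[OF assms compact_Icc]]
  obtain c where c: "\<And>t. t \<in> {a..b} \<Longrightarrow> norm (F t) \<le> c"
    unfolding bounded_iff by blast
  show ?thesis by (rule that[of "max c 0"]) (use c in \<open>auto intro: max.coboundedI1\<close>)
qed

section \<open>Existence, differences, perturbation and uniqueness of gramians\<close>

lemma sylvester_operator_bound:
  fixes A1 :: "real \<Rightarrow> real^'n^'n" and A2 :: "real \<Rightarrow> real^'k^'k"
  assumes "continuous_on {a..b} A1" "continuous_on {a..b} A2"
  obtains c where "0 \<le> c"
    "\<And>t M. t \<in> {a..b} \<Longrightarrow> norm (A1 t ** (M :: real^'k^'n) + M ** transpose (A2 t)) \<le> c * norm M"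
proof -
  obtain k1 where k1: "0 \<le> k1" "\<And>(M::real^'n^'n) (N::real^'k^'n). norm (M ** N) \<le> norm M * norm N * k1"
    using mm.nonneg_bounded by blast
  obtain k2 where k2: "0 \<le> k2" "\<And>(M::real^'k^'n) (N::real^'k^'k). norm (M ** N) \<le> norm M * norm N * k2"
    using mm.nonneg_bounded by blast
  obtain c1 where c1: "0 \<le> c1" "\<And>t. t \<in> {a..b} \<Longrightarrow> norm (A1 t) \<le> c1"
    by (rule continuous_on_Icc_norm_bound[OF assms(1)]) (rule that)
  obtain c2 where c2: "0 \<le> c2" "\<And>t. t \<in> {a..b} \<Longrightarrow> norm (A2 t) \<le> c2"
    by (rule continuous_on_Icc_norm_bound[OF assms(2)]) (rule that)
  show ?thesis
  proof (rule that[of "c1 * k1 + c2 * k2"])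
    fix t and M :: "real^'k^'n" assume t: "t \<in> {a..b}"
    have "norm (A1 t ** M) \<le> c1 * norm M * k1"
      by (intro order_trans[OF k1(2)] mult_right_mono c1 t k1) auto
    moreover have "norm (M ** transpose (A2 t)) \<le> norm M * c2 * k2"
      by (intro order_trans[OF k2(2)] mult_right_mono mult_left_mono) (use c2 k2 t in \<open>auto simp: norm_transpose\<close>)
    ultimately show "norm (A1 t ** M + M ** transpose (A2 t)) \<le> (c1 * k1 + c2 * k2) * norm M"
      by (intro order_trans[OF norm_triangle_ineq]) (simp add: algebra_simps)
  qed (use c1 c2 k1 k2 in auto)
qed

lemma gramian_exists:
  fixes A1 :: "real \<Rightarrow> real^'n^'n" and A2 :: "real \<Rightarrow> real^'k^'k"
  assumes "a \<le> b" "continuous_on {a..b} A1" "continuous_on {a..b} A2" "continuous_on {a..b} F"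
  shows "\<exists>K. gramian a b A1 A2 F K"
proof -
  obtain c where "0 \<le> c" and c: "\<And>t M. t \<in> {a..b} \<Longrightarrow>
      norm (A1 t ** (M :: real^'k^'n) + M ** transpose (A2 t)) \<le> c * norm M"
    by (rule sylvester_operator_bound[OF assms(2,3)]) (rule that)
  obtain K where "K a = 0" "\<And>t. t \<in> {a..b} \<Longrightarrow>
      (K has_vector_derivative (A1 t ** K t + K t ** transpose (A2 t)) + F t) (at t within {a..b})"
  proof (rule linear_ivp_exists[of a b "\<lambda>t M. A1 t ** M + M ** transpose (A2 t)" c F 0])
    show "linear (\<lambda>M. A1 t ** M + M ** transpose (A2 t))" for t
      by (intro bounded_linear.linear bounded_linear_add mm.bounded_linear_left mm.bounded_linear_right)
  qed (auto intro!: continuous_intros assms c)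
  then show ?thesis unfolding gramian_def by blast
qed

text \<open>The splitting of the difference of the right-hand sides is left to the user:
  \<open>G\<close> may contain \<open>K'\<close> itself, which is how a changed coefficient becomes
  a forcing term for the unchanged operator.\<close>

lemma gramian_diff:
  assumes "gramian a b A1' A2' F' K'" "gramian a b A1 A2 F K"
    and "\<And>t. t \<in> {a..b} \<Longrightarrow>
      A1' t ** K' t + K' t ** transpose (A2' t) + F' t - (A1 t ** K t + K t ** transpose (A2 t) + F t)
      = M1 t ** (K' t - K t) + (K' t - K t) ** transpose (M2 t) + G t"
  shows "gramian a b M1 M2 G (\<lambda>t. K' t - K t)"
  unfolding gramian_def
proof (intro conjI ballI)
  fix t assume "t \<in> {a..b}"
  from has_vector_derivative_diff[OF gramianD(2)[OF assms(1) this] gramianD(2)[OF assms(2) this]]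
  show "((\<lambda>t. K' t - K t) has_vector_derivative
      M1 t ** (K' t - K t) + (K' t - K t) ** transpose (M2 t) + G t) (at t within {a..b})"
    unfolding assms(3)[OF \<open>t \<in> {a..b}\<close>] .
qed (use assms in \<open>simp add: gramianD(1)\<close>)

lemmas matrix_bilinear_simps =
  mm.add_left mm.add_right mm.diff_left mm.diff_right mm.minus_left mm.minus_right
  mm.scaleR_left mm.scaleR_right matrix_mul_assoc matrix_transpose_mul
  transpose_add transpose_diff transpose_minus transpose_scalar

text \<open>The error \<open>Ke e - K\<close> solves the unperturbed equation with a forcing of size
  at most |e| d (|error| + k). Gronwall then bounds it by a multiple of |e|, uniformly in
  time.\<close>

lemma gramian_perturbation:
  fixes A1 D1 :: "real \<Rightarrow> real^'n^'n" and A2 D2 :: "real \<Rightarrow> real^'k^'k"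
  assumes "a \<le> b"
    and cont: "continuous_on {a..b} A1" "continuous_on {a..b} D1"
      "continuous_on {a..b} A2" "continuous_on {a..b} D2"
    and K: "gramian a b A1 A2 F K"
    and Ke: "\<And>e. gramian a b (\<lambda>t. A1 t + e *\<^sub>R D1 t) (\<lambda>t. A2 t + e *\<^sub>R D2 t) F (Ke e)"
  shows "uniform_limit {a..b} Ke K (at 0)"
proof -
  obtain c where c: "0 \<le> c" "\<And>t M. t \<in> {a..b} \<Longrightarrow>
      norm (A1 t ** (M :: real^'k^'n) + M ** transpose (A2 t)) \<le> c * norm M"
    by (rule sylvester_operator_bound[OF cont(1,3)]) (rule that)
  obtain d where d: "0 \<le> d" "\<And>t M. t \<in> {a..b} \<Longrightarrow>
      norm (D1 t ** (M :: real^'k^'n) + M ** transpose (D2 t)) \<le> d * norm M"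
    by (rule sylvester_operator_bound[OF cont(2,4)]) (rule that)
  obtain k where k: "0 \<le> k" "\<And>t. t \<in> {a..b} \<Longrightarrow> norm (K t) \<le> k"
    by (rule continuous_on_Icc_norm_bound[OF gramian_continuous[OF K]]) (rule that)
  \<comment> \<open>The Gronwall factor at \<open>t = b\<close>; the rate uses \<open>c + d\<close>
    because a part of the forcing is absorbed below.\<close>
  define N where "N = (b - a) * exp ((2 * (c + d) + 1) * (b - a))"
  have bound: "(norm (Ke e t - K t))\<^sup>2 \<le> (\<bar>e\<bar> * (d * k))\<^sup>2 * N"
    if e: "\<bar>e\<bar> \<le> 1" and t: "t \<in> {a..b}" for e t
  proof -
    let ?E = "\<lambda>t. Ke e t - K t"
    have "gramian a b A1 A2 (\<lambda>t. e *\<^sub>R (D1 t ** Ke e t + Ke e t ** transpose (D2 t))) ?E"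
      by (rule gramian_diff[OF Ke K]) (simp add: matrix_bilinear_simps algebra_simps)
    note E = gramianD[OF this]
    have "(norm (?E t))\<^sup>2 \<le> (\<bar>e\<bar> * (d * k))\<^sup>2 * (t - a) * exp ((2 * (c + d) + 1) * (t - a))"
    proof (rule gronwall_zero_initial[OF E(2,1)])
      fix s assume s: "s \<in> {a..b}"
      have "norm (Ke e s) \<le> norm (?E s) + k"
        using norm_triangle_sub[of "Ke e s" "K s"] k(2)[OF s] by linarith
      then have "norm (D1 s ** Ke e s + Ke e s ** transpose (D2 s)) \<le> d * (norm (?E s) + k)"
        using d order_trans[OF d(2)[OF s]] mult_left_mono by blast
      then have "norm (e *\<^sub>R (D1 s ** Ke e s + Ke e s ** transpose (D2 s))) \<le> \<bar>e\<bar> * (d * (norm (?E s) + k))"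
        by (simp add: mult_left_mono)
      \<comment> \<open>With |e| \<le> 1 the part of the forcing proportional to the error joins the
        Lipschitz constant, and only |e| d k remains as inhomogeneity.\<close>
      moreover have "\<bar>e\<bar> * (d * norm (?E s)) \<le> 1 * (d * norm (?E s))"
        using e d by (intro mult_right_mono) auto
      ultimately show "norm (A1 s ** ?E s + ?E s ** transpose (A2 s)
          + e *\<^sub>R (D1 s ** Ke e s + Ke e s ** transpose (D2 s)))
          \<le> (c + d) * norm (?E s) + \<bar>e\<bar> * (d * k)"
        using c(2)[OF s, of "?E s"] by (intro order_trans[OF norm_triangle_ineq]) (simp add: algebra_simps)
    qed (use c d t in auto)
    also have "\<dots> \<le> (\<bar>e\<bar> * (d * k))\<^sup>2 * N"
      unfolding N_def mult.assoc[of "(\<bar>e\<bar> * (d * k))\<^sup>2"]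
      using t c d by (intro mult_left_mono mult_mono) auto
    finally show ?thesis .
  qed
  define q where "q = d * k * sqrt N"
  have N0: "0 \<le> N" using \<open>a \<le> b\<close> by (simp add: N_def)
  have q0: "0 \<le> q" using d k N0 by (simp add: q_def)
  have bound': "norm (Ke e t - K t) \<le> \<bar>e\<bar> * q" if "\<bar>e\<bar> \<le> 1" "t \<in> {a..b}" for e t
  proof (rule power2_le_imp_le)
    show "(norm (Ke e t - K t))\<^sup>2 \<le> (\<bar>e\<bar> * q)\<^sup>2"
      using bound[OF that] N0 by (simp add: q_def power_mult_distrib mult_ac)
  qed (use q0 in auto)
  show ?thesis
  proof (rule uniform_limitI)
    fix r :: real assume r: "r > 0"
    have "\<forall>\<^sub>F e in at 0. \<bar>e\<bar> < min 1 (r / (q + 1))"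
      using eventually_at_ball[of "min 1 (r / (q + 1))" "0::real" UNIV] r q0
      by (auto elim!: eventually_mono simp: dist_norm)
    then show "\<forall>\<^sub>F e in at 0. \<forall>t\<in>{a..b}. dist (Ke e t) (K t) < r"
    proof (eventually_elim, intro ballI)
      fix e t assume e: "\<bar>e\<bar> < min 1 (r / (q + 1))" and t: "t \<in> {a..b}"
      have "dist (Ke e t) (K t) \<le> \<bar>e\<bar> * q" using bound'[of e t] e t by (simp add: dist_norm)
      also have "\<dots> \<le> r / (q + 1) * q" using e q0 by (intro mult_right_mono) auto
      also have "\<dots> < r" using r q0 by (simp add: field_simps)
      finally show "dist (Ke e t) (K t) < r" .
    qed
  qed
qed

lemma gramian_unique:
  assumes "a \<le> b" "continuous_on {a..b} A1" "continuous_on {a..b} A2"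
    and "gramian a b A1 A2 F K" "gramian a b A1 A2 F K'" "t \<in> {a..b}"
  shows "K' t = K t"
proof -
  \<comment> \<open>Under the zero perturbation the constant family \<open>K'\<close> converges to \<open>K\<close>.\<close>
  have "uniform_limit {a..b} (\<lambda>_. K') K (at (0::real))"
    by (rule gramian_perturbation[of a b A1 "\<lambda>_. 0" A2 "\<lambda>_. 0" F]) (use assms in auto)
  from tendsto_uniform_limitI[OF this assms(6)] show ?thesis
    by (simp add: tendsto_const_iff)
qed

text \<open>The transpose solves the same initial value problem. Symmetry later merges the
  contributions of a direction and of its transpose.\<close>

lemma gramian_symmetric:
  assumes "a \<le> b" "continuous_on {a..b} A" "gramian a b A A F K"
    and "\<And>t. t \<in> {a..b} \<Longrightarrow> transpose (F t) = F t" "t \<in> {a..b}"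
  shows "transpose (K t) = K t"
proof (rule gramian_unique[OF assms(1,2,2,3) _ assms(5)])
  show "gramian a b A A F (\<lambda>t. transpose (K t))"
    unfolding gramian_def
  proof (intro conjI ballI)
    fix s assume s: "s \<in> {a..b}"
    from has_vector_derivative_transpose[OF gramianD(2)[OF assms(3) s]]
    show "((\<lambda>t. transpose (K t)) has_vector_derivative
        A s ** transpose (K s) + transpose (K s) ** transpose (A s) + F s) (at s within {a..b})"
      using assms(4)[OF s] by (simp add: matrix_bilinear_simps add_ac)
  qed (use assms(3) in \<open>simp add: gramian_def transpose_0\<close>)
qed

text \<open>In the derivative of L \<bullet> K the operator terms cancel by adjointness, leaving
  \<open>L t \<bullet> F t - H t \<bullet> K t\<close>. The boundary terms vanish, \<open>K\<close>
  being zero at \<open>a\<close> and \<open>L\<close> at \<open>b\<close>.\<close>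

lemma gramian_duality:
  assumes "a \<le> b" and K: "gramian a b A1 A2 F K" and L: "cogramian a b A1 A2 H L"
    and "continuous_on {a..b} F" "continuous_on {a..b} H"
  shows "integral {a..b} (\<lambda>t. H t \<bullet> K t) = integral {a..b} (\<lambda>t. L t \<bullet> F t)"
proof -
  have "((\<lambda>t. L t \<bullet> F t - H t \<bullet> K t) has_integral L b \<bullet> K b - L a \<bullet> K a) {a..b}"
  proof (rule fundamental_theorem_of_calculus[OF \<open>a \<le> b\<close>])
    fix t assume t: "t \<in> {a..b}"
    have "((\<lambda>t. L t \<bullet> K t) has_vector_derivative
        L t \<bullet> (A1 t ** K t + K t ** transpose (A2 t) + F t)
        + (- (transpose (A1 t) ** L t + L t ** A2 t + H t)) \<bullet> K t) (at t within {a..b})"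
      by (intro bounded_bilinear.has_vector_derivative[OF bounded_bilinear_inner]
          gramianD(2)[OF K t] cogramianD(2)[OF L t])
    moreover have "L t \<bullet> (A1 t ** K t) = (transpose (A1 t) ** L t) \<bullet> K t"
      using inner_matrix_mul_left[of "A1 t" "K t" "L t"] by (simp only: inner_commute)
    moreover have "L t \<bullet> (K t ** transpose (A2 t)) = (L t ** A2 t) \<bullet> K t"
      by (rule inner_matrix_mul_right[symmetric])
    ultimately show "((\<lambda>t. L t \<bullet> K t) has_vector_derivative L t \<bullet> F t - H t \<bullet> K t) (at t within {a..b})"
      by (simp add: inner_add_left inner_add_right algebra_simps)
  qed
  then have "integral {a..b} (\<lambda>t. L t \<bullet> F t - H t \<bullet> K t) = 0"
    using gramianD(1)[OF K] cogramianD(1)[OF L] by (simp add: integral_unique)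
  moreover have "(\<lambda>t. L t \<bullet> F t) integrable_on {a..b}" "(\<lambda>t. H t \<bullet> K t) integrable_on {a..b}"
    by (intro integrable_continuous_real continuous_intros assms gramian_continuous[OF K] cogramian_continuous[OF L])+
  ultimately show ?thesis by (simp add: integral_diff)
qed

text \<open>Duality with a suitable forward solution takes the place of a uniqueness theorem for the
  terminal value problem.\<close>

lemma cogramian_symmetric:
  fixes A :: "real \<Rightarrow> real^'n^'n"
  assumes "a < b" "continuous_on {a..b} A" and L: "cogramian a b A A H L"
    and H: "\<And>t. t \<in> {a..b} \<Longrightarrow> transpose (H t) = H t" and t: "t \<in> {a..b}"
  shows "transpose (L t) = L t"
proof -
  let ?E = "\<lambda>t. transpose (L t) - L t"
  have E: "cogramian a b A A (\<lambda>_. 0) ?E"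
    unfolding cogramian_def
  proof (intro conjI ballI)
    fix s assume s: "s \<in> {a..b}"
    note dL = cogramianD(2)[OF L s]
    from has_vector_derivative_diff[OF has_vector_derivative_transpose[OF dL] dL]
    show "(?E has_vector_derivative - (transpose (A s) ** ?E s + ?E s ** A s + 0)) (at s within {a..b})"
      using H[OF s] by (simp add: matrix_bilinear_simps algebra_simps)
  qed (use L in \<open>simp add: cogramian_def transpose_0\<close>)
  have cE: "continuous_on {a..b} ?E" by (rule cogramian_continuous[OF E])
  \<comment> \<open>Pairing \<open>L\<^sup>T - L\<close> with the gramian driven by itself gives its squared norm.\<close>
  obtain M where M: "gramian a b A A ?E M"
    using gramian_exists[OF _ assms(2,2) cE] \<open>a < b\<close> by auto
  have "integral {a..b} (\<lambda>t. ?E t \<bullet> ?E t) = 0"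
    using gramian_duality[OF _ M E cE] \<open>a < b\<close> by simp
  then have "?E t \<bullet> ?E t = 0"
    using integral_eq_0_iff[of a b "\<lambda>t. ?E t \<bullet> ?E t"] continuous_on_inner[OF cE cE] \<open>a < b\<close> t by simp
  then show ?thesis by simp
qed

text \<open>An explicit antiderivative in \<open>\<tau>\<close> exists: multiplying \<open>K\<close>
  by \<open>\<Psi>1\<close> on the left and by the transpose of \<open>\<Psi>2\<close> on the right
  cancels both coefficient terms of its derivative, so only the source survives. Variation of
  constants is thus verified by differentiation.\<close>

lemma impulse_response_inner_has_integral:
  fixes A1 :: "real \<Rightarrow> real^'n^'n" and A2 :: "real \<Rightarrow> real^'k^'k"
    and B1 :: "real \<Rightarrow> real^'m^'n" and B2 :: "real \<Rightarrow> real^'m^'k"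
    and C1 :: "real^'n^'p" and C2 :: "real^'k^'p"
  assumes "a \<le> b" and cont: "continuous_on {a..b} A1" "continuous_on {a..b} A2"
    and K: "gramian a b A1 A2 (\<lambda>t. B1 t ** transpose (B2 t)) K" and t: "t \<in> {a..b}"
  shows "((\<lambda>\<tau>. (C1 ** state_transition a b A1 t \<tau> ** B1 \<tau>) \<bullet> (C2 ** state_transition a b A2 t \<tau> ** B2 \<tau>))
    has_integral (transpose C1 ** C2) \<bullet> K t) {a..t}"
proof -
  obtain \<Phi>1 \<Psi>1 :: "real \<Rightarrow> real^'n^'n" where 1:
    "\<And>t \<tau>. t \<in> {a..b} \<Longrightarrow> \<tau> \<in> {a..b} \<Longrightarrow> state_transition a b A1 t \<tau> = \<Phi>1 t ** \<Psi>1 \<tau>"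
    "\<And>t. t \<in> {a..b} \<Longrightarrow> (\<Psi>1 has_vector_derivative - (\<Psi>1 t ** A1 t)) (at t within {a..b})"
    "\<And>t. t \<in> {a..b} \<Longrightarrow> \<Phi>1 t ** \<Psi>1 t = mat 1"
    by (rule state_transition_factorization[OF \<open>a \<le> b\<close> cont(1)]) (rule that)
  obtain \<Phi>2 \<Psi>2 :: "real \<Rightarrow> real^'k^'k" where 2:
    "\<And>t \<tau>. t \<in> {a..b} \<Longrightarrow> \<tau> \<in> {a..b} \<Longrightarrow> state_transition a b A2 t \<tau> = \<Phi>2 t ** \<Psi>2 \<tau>"
    "\<And>t. t \<in> {a..b} \<Longrightarrow> (\<Psi>2 has_vector_derivative - (\<Psi>2 t ** A2 t)) (at t within {a..b})"
    "\<And>t. t \<in> {a..b} \<Longrightarrow> \<Phi>2 t ** \<Psi>2 t = mat 1"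
    by (rule state_transition_factorization[OF \<open>a \<le> b\<close> cont(2)]) (rule that)
  \<comment> \<open>With \<open>t\<close> fixed, \<open>G\<close> undoes \<open>\<Psi>1\<close> and
    \<open>\<Psi>2\<close> at \<open>\<tau> = t\<close> and applies the output weights. Being
    bounded and linear, it commutes with the derivative in \<open>\<tau>\<close>.\<close>
  define G where "G = (\<lambda>M. (transpose C1 ** C2) \<bullet> (\<Phi>1 t ** M ** transpose (\<Phi>2 t)))"
  have G: "bounded_linear G"
    unfolding G_def
    by (intro bounded_linear_compose[OF bounded_linear_inner_right]
        bounded_linear_compose[OF mm.bounded_linear_left] mm.bounded_linear_right)
  let ?g = "\<lambda>\<tau>. \<Psi>1 \<tau> ** K \<tau> ** transpose (\<Psi>2 \<tau>)"
  have I: "((\<lambda>\<tau>. G (\<Psi>1 \<tau> ** (B1 \<tau> ** transpose (B2 \<tau>)) ** transpose (\<Psi>2 \<tau>)))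
      has_integral G (?g t) - G (?g a)) {a..t}"
  proof (rule fundamental_theorem_of_calculus)
    fix s assume s: "s \<in> {a..t}"
    then have s': "s \<in> {a..b}" using t by auto
    from mm.has_vector_derivative[OF mm.has_vector_derivative[OF 1(2)[OF s'] gramianD(2)[OF K s']]
        has_vector_derivative_transpose[OF 2(2)[OF s']]]
    have "(?g has_vector_derivative \<Psi>1 s ** (B1 s ** transpose (B2 s)) ** transpose (\<Psi>2 s)) (at s within {a..b})"
      by (simp add: matrix_bilinear_simps algebra_simps)
    from bounded_linear.has_vector_derivative[OF G has_vector_derivative_within_subset[OF this]]
    show "((\<lambda>\<tau>. G (?g \<tau>)) has_vector_derivative
        G (\<Psi>1 s ** (B1 s ** transpose (B2 s)) ** transpose (\<Psi>2 s))) (at s within {a..t})"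
      using t by auto
  qed (use t in auto)
  have ga: "G (?g a) = 0" using K by (simp add: gramian_def G_def)
  have gt: "G (?g t) = (transpose C1 ** C2) \<bullet> K t"
  proof -
    have "\<Phi>1 t ** ?g t ** transpose (\<Phi>2 t) = (\<Phi>1 t ** \<Psi>1 t) ** K t ** transpose (\<Phi>2 t ** \<Psi>2 t)"
      by (simp add: matrix_mul_assoc matrix_transpose_mul)
    then show ?thesis using 1(3)[OF t] 2(3)[OF t] by (simp add: G_def)
  qed
  have "G (\<Psi>1 \<tau> ** (B1 \<tau> ** transpose (B2 \<tau>)) ** transpose (\<Psi>2 \<tau>)) =
      (C1 ** state_transition a b A1 t \<tau> ** B1 \<tau>) \<bullet> (C2 ** state_transition a b A2 t \<tau> ** B2 \<tau>)"
    if "\<tau> \<in> {a..t}" for \<tau>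
  proof -
    have \<tau>: "\<tau> \<in> {a..b}" using that t by auto
    have "(C1 ** M) \<bullet> (C2 ** N) = (transpose C1 ** C2) \<bullet> (M ** transpose N)"
      for M :: "real^'m^'n" and N :: "real^'m^'k"
      by (metis inner_matrix_mul_left inner_matrix_mul_right inner_commute matrix_mul_assoc)
    from this[of "\<Phi>1 t ** \<Psi>1 \<tau> ** B1 \<tau>" "\<Phi>2 t ** \<Psi>2 \<tau> ** B2 \<tau>"] show ?thesis
      unfolding 1(1)[OF t \<tau>] 2(1)[OF t \<tau>] G_def by (simp add: matrix_mul_assoc matrix_transpose_mul)
  qed
  from has_integral_eq[OF this I] show ?thesis by (simp add: ga gt)
qed

text \<open>Expanding the square of the norm gives three pairings of impulse responses, with
  coefficient pairs (A, A), (A, Ar) and (Ar, Ar).\<close>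

lemma H2_error_sq_gramian:
  assumes "a \<le> b" "continuous_on {a..b} A" "continuous_on {a..b} Ar"
    and P: "gramian a b A A (\<lambda>t. B t ** transpose (B t)) P"
    and X: "gramian a b A Ar (\<lambda>t. B t ** transpose (Br t)) X"
    and Pr: "gramian a b Ar Ar (\<lambda>t. Br t ** transpose (Br t)) Pr"
  shows "H2_error_sq a b A B C Ar Br Cr = integral {a..b} (\<lambda>t.
    (transpose (C t) ** C t) \<bullet> P t - 2 * ((transpose (C t) ** Cr t) \<bullet> X t) + (transpose (Cr t) ** Cr t) \<bullet> Pr t)"
  unfolding H2_error_sq_def
proof (rule integral_cong)
  fix t assume t: "t \<in> {a..b}"
  let ?u = "\<lambda>\<tau>. C t ** state_transition a b A t \<tau> ** B \<tau>"
  let ?v = "\<lambda>\<tau>. Cr t ** state_transition a b Ar t \<tau> ** Br \<tau>"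
  have "((\<lambda>\<tau>. ?u \<tau> \<bullet> ?u \<tau> - 2 * (?u \<tau> \<bullet> ?v \<tau>) + ?v \<tau> \<bullet> ?v \<tau>) has_integral
      (transpose (C t) ** C t) \<bullet> P t - 2 * ((transpose (C t) ** Cr t) \<bullet> X t)
      + (transpose (Cr t) ** Cr t) \<bullet> Pr t) {a..t}"
    by (intro has_integral_add has_integral_diff has_integral_mult_right
        impulse_response_inner_has_integral assms t)
  moreover have "(norm (?u \<tau> - ?v \<tau>))\<^sup>2 = ?u \<tau> \<bullet> ?u \<tau> - 2 * (?u \<tau> \<bullet> ?v \<tau>) + ?v \<tau> \<bullet> ?v \<tau>" for \<tau>
    by (simp add: power2_norm_eq_inner inner_diff_left inner_diff_right inner_commute)
  ultimately show "integral {a..t} (\<lambda>\<tau>. (norm (?u \<tau> - ?v \<tau>))\<^sup>2) =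
      (transpose (C t) ** C t) \<bullet> P t - 2 * ((transpose (C t) ** Cr t) \<bullet> X t)
      + (transpose (Cr t) ** Cr t) \<bullet> Pr t"
    by (simp add: integral_unique)
qed

subsection \<open>Inverse matrices and vanishing first variations\<close>

text \<open>The difference quotient form lets limit laws for products act on the derivative of an
  inverse.\<close>

lemma has_vector_derivative_iff_tendsto:
  fixes F :: "real \<Rightarrow> 'a::real_normed_vector"
  shows "(F has_vector_derivative F') (at t within S) \<longleftrightarrow>
    ((\<lambda>s. (F s - F t) /\<^sub>R (s - t)) \<longlongrightarrow> F') (at t within S)"
proof -
  have "norm ((1 / norm (s - t)) *\<^sub>R (F s - (F t + (s - t) *\<^sub>R F')))
      = norm ((F s - F t) /\<^sub>R (s - t) - F')" if "s \<noteq> t" for s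
  proof -
    have "F s - (F t + (s - t) *\<^sub>R F') = (s - t) *\<^sub>R ((F s - F t) /\<^sub>R (s - t) - F')"
      using that by (simp add: scaleR_diff_right)
    then show ?thesis using that by simp
  qed
  then have "((\<lambda>s. norm ((1 / norm (s - t)) *\<^sub>R (F s - (F t + (s - t) *\<^sub>R F')))) \<longlongrightarrow> 0) (at t within S) \<longleftrightarrow>
      ((\<lambda>s. norm ((F s - F t) /\<^sub>R (s - t) - F')) \<longlongrightarrow> 0) (at t within S)"
    by (intro Lim_cong_within refl) auto
  then show ?thesis
    unfolding has_vector_derivative_def has_derivative_within
      tendsto_norm_zero_iff LIM_zero_iff
    by (simp add: bounded_linear_scaleR_left)
qed

lemma matrix_inv_mult:
  assumes "invertible (M :: real^'n^'n)"
  shows "M ** matrix_inv M = mat 1" "matrix_inv M ** M = mat 1"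
  using someI_ex[OF assms[unfolded invertible_def]] unfolding matrix_inv_def by auto

text \<open>\<open>matrix_inv\<close> is a choice, without usable value at singular matrices, so the
  determinant first secures invertibility eventually. The rest is the identity U - R = - U (F x - M)
  R for the two inverses.\<close>

lemma tendsto_matrix_inv:
  fixes F :: "'a \<Rightarrow> real^'n^'n"
  assumes F: "(F \<longlongrightarrow> M) net" and M: "invertible M"
  shows "((\<lambda>x. matrix_inv (F x)) \<longlongrightarrow> matrix_inv M) net"
    and "\<forall>\<^sub>F x in net. invertible (F x)"
proof -
  have "((\<lambda>x. det (F x)) \<longlongrightarrow> det M) net"
    unfolding det_def by (intro tendsto_intros F)
  then have "\<forall>\<^sub>F x in net. det (F x) \<noteq> 0"
    using M by (intro tendsto_imp_eventually_ne) (auto simp: invertible_det_nz)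
  then show inv: "\<forall>\<^sub>F x in net. invertible (F x)" by (simp add: invertible_det_nz)
  let ?R = "matrix_inv M"
  obtain k where k: "0 \<le> k" "\<And>(U::real^'n^'n) (V::real^'n^'n). norm (U ** V) \<le> norm U * norm V * k"
    using mm.nonneg_bounded by blast
  \<comment> \<open>Bounds |U - R| / |U|; the two factors \<open>k\<close> come from the two
    products in U (F x - M) R. Once it is below 1/2, the triangle inequality gives |U| \<le> 2
    |R|.\<close>
  let ?h = "\<lambda>x. k * k * norm ?R * norm (F x - M)"
  have h: "(?h \<longlongrightarrow> 0) net"
    using F by (auto intro!: tendsto_mult_right_zero simp: LIM_zero tendsto_norm_zero)
  have small: "\<forall>\<^sub>F x in net. ?h x < 1/2" by (rule order_tendstoD(2)[OF h]) simp
  have "\<forall>\<^sub>F x in net. norm (matrix_inv (F x) - ?R) \<le> 2 * norm ?R * ?h x"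
    using inv small
  proof eventually_elim
    fix x assume Fx: "invertible (F x)" and hx: "?h x < 1/2"
    let ?U = "matrix_inv (F x)"
    have "?U - ?R = - (?U ** (F x - M) ** ?R)"
      using matrix_inv_mult[OF Fx] matrix_inv_mult[OF M]
      by (simp add: mm.diff_left mm.diff_right) (simp add: matrix_mul_assoc[symmetric])
    then have "norm (?U - ?R) \<le> norm ?U * ?h x"
      using k(2)[of "?U ** (F x - M)" ?R]
        mult_right_mono[OF k(2)[of ?U "F x - M"], of "norm ?R * k"] k(1)
      by (simp add: mult_ac)
    moreover have "norm ?U \<le> norm ?R + norm (?U - ?R)" using norm_triangle_sub by blast
    moreover have "norm ?U * ?h x \<le> norm ?U * (1/2)" using hx by (intro mult_left_mono) auto
    ultimately have U: "norm ?U \<le> 2 * norm ?R" by linarith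
    have "0 \<le> ?h x" using k by simp
    show "norm (?U - ?R) \<le> 2 * norm ?R * ?h x"
      by (rule order_trans[OF \<open>norm (?U - ?R) \<le> norm ?U * ?h x\<close> mult_right_mono[OF U \<open>0 \<le> ?h x\<close>]])
  qed
  then have "((\<lambda>x. matrix_inv (F x) - ?R) \<longlongrightarrow> 0) net"
    by (rule Lim_null_comparison) (rule tendsto_mult_right_zero[OF h])
  then show "((\<lambda>x. matrix_inv (F x)) \<longlongrightarrow> ?R) net" by (rule LIM_zero_cancel)
qed

text \<open>Invertibility at the single point \<open>t\<close> suffices: it spreads to nearby
  points, where the same identity rewrites the difference quotient of the inverse.\<close>

lemma has_vector_derivative_matrix_inv:
  fixes F :: "real \<Rightarrow> real^'n^'n"
  assumes F: "(F has_vector_derivative F') (at t within S)" and inv: "invertible (F t)"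
  shows "((\<lambda>s. matrix_inv (F s)) has_vector_derivative
    - (matrix_inv (F t) ** F' ** matrix_inv (F t))) (at t within S)"
proof -
  let ?R = "\<lambda>s. matrix_inv (F s)"
  have Ft: "(F \<longlongrightarrow> F t) (at t within S)"
    using has_vector_derivative_continuous[OF F] by (simp add: continuous_within)
  note R = tendsto_matrix_inv[OF Ft inv]
  have "((\<lambda>s. - (?R s ** ((F s - F t) /\<^sub>R (s - t)) ** ?R t)) \<longlongrightarrow> - (?R t ** F' ** ?R t)) (at t within S)"
    using F unfolding has_vector_derivative_iff_tendsto
    by (intro tendsto_minus mm.tendsto R(1) tendsto_const)
  moreover have "\<forall>\<^sub>F s in at t within S.
      - (?R s ** ((F s - F t) /\<^sub>R (s - t)) ** ?R t) = (?R s - ?R t) /\<^sub>R (s - t)"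
    using R(2)
  proof eventually_elim
    fix s assume Fs: "invertible (F s)"
    have "?R s - ?R t = - (?R s ** (F s - F t) ** ?R t)"
      using matrix_inv_mult[OF Fs] matrix_inv_mult[OF inv]
      by (simp add: mm.diff_left mm.diff_right) (simp add: matrix_mul_assoc[symmetric])
    then show "- (?R s ** ((F s - F t) /\<^sub>R (s - t)) ** ?R t) = (?R s - ?R t) /\<^sub>R (s - t)"
      by (simp add: mm.scaleR_left mm.scaleR_right)
  qed
  ultimately show ?thesis
    unfolding has_vector_derivative_iff_tendsto by (rule Lim_transform_eventually)
qed

text \<open>The direction D = G makes the integrand a nonnegative continuous function. The factor 2
  is the one with which the first variations arrive.\<close>

lemma zero_of_integral_test_functions:
  fixes G :: "real \<Rightarrow> 'a::euclidean_space"
  assumes "a < b" "continuous_on {a..b} G"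
    and "\<And>D. continuous_on {a..b} D \<Longrightarrow> integral {a..b} (\<lambda>t. 2 * (D t \<bullet> G t)) = 0"
    and "t \<in> {a..b}"
  shows "G t = 0"
proof -
  have "integral {a..b} (\<lambda>t. 2 * (G t \<bullet> G t)) = 0" by (rule assms(3)[OF assms(2)])
  moreover have "continuous_on {a..b} (\<lambda>t. 2 * (G t \<bullet> G t))"
    by (intro continuous_intros assms(2))
  ultimately have "2 * (G t \<bullet> G t) = 0"
    using integral_eq_0_iff[of a b "\<lambda>t. 2 * (G t \<bullet> G t)"] assms(1,4) by simp
  then show ?thesis by simp
qed

text \<open>With \<open>e\<close> factored out exactly, a limit of \<open>S\<close> suffices and no
  gramian has to be differentiated in \<open>e\<close>.\<close>

lemma first_variation_zero:
  fixes J S :: "real \<Rightarrow> real"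
  assumes "((\<lambda>e. (J e - J0) / e) \<longlongrightarrow> 0) (at 0)" "\<And>e. J e - J0 = e * S e" "(S \<longlongrightarrow> s) (at 0)"
  shows "s = 0"
proof -
  have "(S \<longlongrightarrow> 0) (at 0)"
  proof (rule Lim_transform_eventually[OF assms(1)])
    show "\<forall>\<^sub>F e in at 0. (J e - J0) / e = S e"
      unfolding assms(2) by (simp add: eventually_at_filter)
  qed
  from tendsto_unique[OF _ assms(3) this] show ?thesis by simp
qed

lemma tendsto_integral_uniform_limit:
  fixes f :: "'b \<Rightarrow> real \<Rightarrow> 'a::banach"
  assumes "uniform_limit {a..b} f g F" "\<And>n. continuous_on {a..b} (f n)" "F \<noteq> bot"
  shows "((\<lambda>n. integral {a..b} (f n)) \<longlongrightarrow> integral {a..b} g) F"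
proof -
  obtain I J where I: "\<And>n. (f n has_integral I n) {a..b}"
    and J: "(g has_integral J) {a..b}" and lim: "(I \<longlongrightarrow> J) F"
    by (rule uniform_limit_integral[OF assms]) (rule that)
  show ?thesis using lim by (simp add: integral_unique[OF I] integral_unique[OF J])
qed

text \<open>For input and output directions the error is a quadratic polynomial in \<open>e\<close>;
  its difference quotient is affine.\<close>

lemma first_variation_zero_quadratic:
  fixes J g h :: "real \<Rightarrow> real"
  assumes "((\<lambda>e. (J e - J0) / e) \<longlongrightarrow> 0) (at 0)"
    and J: "\<And>e. J e - J0 = integral {a..b} (\<lambda>t. e * (g t + e * h t))"
    and cont: "continuous_on {a..b} g" "continuous_on {a..b} h"
  shows "integral {a..b} g = 0"
proof (rule first_variation_zero[OF assms(1)])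
  show "J e - J0 = e * (integral {a..b} g + e * integral {a..b} h)" for e
    using J[of e] integral_add[of g "{a..b}" "\<lambda>t. e * h t"]
      integrable_continuous_real[OF cont(1)]
      integrable_continuous_real[OF continuous_on_mult_left[OF cont(2)], of e]
    by simp
  have "((\<lambda>e. integral {a..b} g + e * integral {a..b} h) \<longlongrightarrow> integral {a..b} g + 0 * integral {a..b} h) (at 0)"
    by (intro tendsto_intros)
  then show "((\<lambda>e. integral {a..b} g + e * integral {a..b} h) \<longlongrightarrow> integral {a..b} g) (at 0)"
    by simp
qed

subsection \<open>Stationarity conditions\<close>

text \<open>\<open>P\<close> is carried along because the gramian formula for \<open>J\<close>
  contains it; it cancels in every difference of values of \<open>J\<close>.\<close>

locale reduced_model =
  fixes t0 tf :: real
    and A :: "real \<Rightarrow> real^'n^'n" and B :: "real \<Rightarrow> real^'m^'n" and C :: "real \<Rightarrow> real^'n^'p"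
    and Ar :: "real \<Rightarrow> real^'r^'r" and Br :: "real \<Rightarrow> real^'m^'r" and Cr :: "real \<Rightarrow> real^'r^'p"
    and P :: "real \<Rightarrow> real^'n^'n" and Pr Qr :: "real \<Rightarrow> real^'r^'r" and X Y :: "real \<Rightarrow> real^'r^'n"
  assumes t0_less_tf: "t0 < tf"
    and cont: "continuous_on {t0..tf} A" "continuous_on {t0..tf} B" "continuous_on {t0..tf} C"
      "continuous_on {t0..tf} Ar" "continuous_on {t0..tf} Br" "continuous_on {t0..tf} Cr"
    and P: "gramian t0 tf A A (\<lambda>t. B t ** transpose (B t)) P"
    and Pr: "gramian t0 tf Ar Ar (\<lambda>t. Br t ** transpose (Br t)) Pr"
    and X: "gramian t0 tf A Ar (\<lambda>t. B t ** transpose (Br t)) X"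
    and Qr: "cogramian t0 tf Ar Ar (\<lambda>t. transpose (Cr t) ** Cr t) Qr"
    and Y: "cogramian t0 tf A Ar (\<lambda>t. transpose (C t) ** Cr t) Y"
begin

abbreviation J where "J \<equiv> H2_error_sq t0 tf A B C"

lemmas cont_gramians =
  gramian_continuous[OF P] gramian_continuous[OF Pr] gramian_continuous[OF X]
  cogramian_continuous[OF Qr] cogramian_continuous[OF Y]

lemma t0_le_tf: "t0 \<le> tf" using t0_less_tf by simp

lemma Pr_symmetric: "t \<in> {t0..tf} \<Longrightarrow> transpose (Pr t) = Pr t"
  by (rule gramian_symmetric[OF t0_le_tf cont(4) Pr]) (simp add: matrix_transpose_mul)

lemma Qr_symmetric: "t \<in> {t0..tf} \<Longrightarrow> transpose (Qr t) = Qr t"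
  by (rule cogramian_symmetric[OF t0_less_tf cont(4) Qr]) (simp add: matrix_transpose_mul)

text \<open>The forcings \<open>G\<close> and \<open>H\<close> stay arbitrary so that changes of
  \<open>Ar\<close> and of \<open>Br\<close> are treated alike. The identity is exact: the
  differences solve the unperturbed equations, and duality moves them onto \<open>Qr\<close> and
  \<open>Y\<close>.\<close>

lemma J_variation_state_input:
  assumes cont': "continuous_on {t0..tf} Ar'" "continuous_on {t0..tf} G" "continuous_on {t0..tf} H"
    and Pr': "gramian t0 tf Ar' Ar' (\<lambda>t. Br' t ** transpose (Br' t)) Pr'"
    and X': "gramian t0 tf A Ar' (\<lambda>t. B t ** transpose (Br' t)) X'"
    and dPr: "gramian t0 tf Ar Ar G (\<lambda>t. Pr' t - Pr t)"
    and dX: "gramian t0 tf A Ar H (\<lambda>t. X' t - X t)"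
  shows "J Ar' Br' Cr - J Ar Br Cr = integral {t0..tf} (\<lambda>t. Qr t \<bullet> G t - 2 * (Y t \<bullet> H t))"
proof -
  note ci = integrable_continuous_real continuous_intros cont cont' cont_gramians
    gramian_continuous[OF Pr'] gramian_continuous[OF X']
    gramian_continuous[OF dPr] gramian_continuous[OF dX]
  let ?j = "\<lambda>Pr X t. (transpose (C t) ** C t) \<bullet> P t - 2 * ((transpose (C t) ** Cr t) \<bullet> X t)
      + (transpose (Cr t) ** Cr t) \<bullet> Pr t"
  have "J Ar' Br' Cr - J Ar Br Cr = integral {t0..tf} (?j Pr' X') - integral {t0..tf} (?j Pr X)"
    using H2_error_sq_gramian[OF t0_le_tf cont(1) cont'(1) P X' Pr', of C Cr]
      H2_error_sq_gramian[OF t0_le_tf cont(1,4) P X Pr, of C Cr] by simp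
  also have "\<dots> = integral {t0..tf} (\<lambda>t. ?j Pr' X' t - ?j Pr X t)"
    by (rule integral_diff[symmetric]; intro ci)
  also have "\<dots> = integral {t0..tf} (\<lambda>t. (transpose (Cr t) ** Cr t) \<bullet> (Pr' t - Pr t)
      - 2 * ((transpose (C t) ** Cr t) \<bullet> (X' t - X t)))"
    by (simp add: inner_diff_right algebra_simps)
  also have "\<dots> = integral {t0..tf} (\<lambda>t. (transpose (Cr t) ** Cr t) \<bullet> (Pr' t - Pr t))
      - 2 * integral {t0..tf} (\<lambda>t. (transpose (C t) ** Cr t) \<bullet> (X' t - X t))"
    by (subst integral_diff) (intro ci | simp)+
  also have "integral {t0..tf} (\<lambda>t. (transpose (Cr t) ** Cr t) \<bullet> (Pr' t - Pr t))
      = integral {t0..tf} (\<lambda>t. Qr t \<bullet> G t)"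
    by (rule gramian_duality[OF t0_le_tf dPr Qr]; intro ci)
  also have "integral {t0..tf} (\<lambda>t. (transpose (C t) ** Cr t) \<bullet> (X' t - X t))
      = integral {t0..tf} (\<lambda>t. Y t \<bullet> H t)"
    by (rule gramian_duality[OF t0_le_tf dX Y]; intro ci)
  also have "integral {t0..tf} (\<lambda>t. Qr t \<bullet> G t) - 2 * integral {t0..tf} (\<lambda>t. Y t \<bullet> H t)
      = integral {t0..tf} (\<lambda>t. Qr t \<bullet> G t - 2 * (Y t \<bullet> H t))"
    by (subst integral_diff) (intro ci | simp)+
  finally show ?thesis .
qed

text \<open>The gramians \<open>Pr\<close> and \<open>X\<close> do not depend on \<open>Cr\<close>,
  so the integrand is directly quadratic in the direction and no adjoint is involved.\<close>

lemma stationary_output: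
  assumes stat: "\<And>D. continuous_on {t0..tf} D \<Longrightarrow>
      ((\<lambda>e. (J Ar Br (\<lambda>t. Cr t + e *\<^sub>R D t) - J Ar Br Cr) / e) \<longlongrightarrow> 0) (at 0)"
    and t: "t \<in> {t0..tf}"
  shows "Cr t ** Pr t = C t ** X t"
proof -
  let ?G = "\<lambda>t. Cr t ** Pr t - C t ** X t"
  have "?G t = 0"
  proof (rule zero_of_integral_test_functions[OF t0_less_tf _ _ t])
    show "continuous_on {t0..tf} ?G" by (intro continuous_intros cont cont_gramians)
    fix D :: "real \<Rightarrow> real^'r^'p" assume D: "continuous_on {t0..tf} D"
    let ?h = "\<lambda>t. (transpose (D t) ** D t) \<bullet> Pr t"
    show "integral {t0..tf} (\<lambda>t. 2 * (D t \<bullet> ?G t)) = 0"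
    proof (rule first_variation_zero_quadratic[OF stat[OF D], where h = ?h])
      fix e
      let ?j = "\<lambda>Cr t. (transpose (C t) ** C t) \<bullet> P t - 2 * ((transpose (C t) ** Cr t) \<bullet> X t)
          + (transpose (Cr t) ** Cr t) \<bullet> Pr t"
      let ?C' = "\<lambda>t. Cr t + e *\<^sub>R D t"
      have "J Ar Br ?C' - J Ar Br Cr = integral {t0..tf} (?j ?C') - integral {t0..tf} (?j Cr)"
        using H2_error_sq_gramian[OF t0_le_tf cont(1,4) P X Pr, of C] by simp
      also have "\<dots> = integral {t0..tf} (\<lambda>t. ?j ?C' t - ?j Cr t)"
        by (rule integral_diff[symmetric];
            intro integrable_continuous_real continuous_intros cont cont_gramians D)
      also have "\<dots> = integral {t0..tf} (\<lambda>t. e * (2 * (D t \<bullet> ?G t) + e * ?h t))"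
      proof (rule integral_cong)
        fix s assume s: "s \<in> {t0..tf}"
        have "(transpose (C s) ** D s) \<bullet> X s = D s \<bullet> (C s ** X s)"
          using inner_matrix_mul_left[of "transpose (C s)" "D s" "X s"] by simp
        moreover have "(transpose (Cr s) ** D s) \<bullet> Pr s = D s \<bullet> (Cr s ** Pr s)"
          using inner_matrix_mul_left[of "transpose (Cr s)" "D s" "Pr s"] by simp
        \<comment> \<open>Symmetry of \<open>Pr\<close> makes the two cross terms equal, whence the
          factor 2.\<close>
        moreover have "(transpose (D s) ** Cr s) \<bullet> Pr s = D s \<bullet> (Cr s ** Pr s)"
          using inner_transpose[of "transpose (D s) ** Cr s" "Pr s"] calculation(2)
          by (simp add: matrix_transpose_mul Pr_symmetric[OF s])
        ultimately show "?j ?C' s - ?j Cr s = e * (2 * (D s \<bullet> ?G s) + e * ?h s)"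
          by (simp add: matrix_bilinear_simps inner_add_left inner_diff_right algebra_simps)
      qed
      finally show "J Ar Br ?C' - J Ar Br Cr = \<dots>" .
    qed (intro continuous_intros cont cont_gramians D)+
  qed
  then show ?thesis by simp
qed

lemma stationary_input:
  assumes stat: "\<And>D. continuous_on {t0..tf} D \<Longrightarrow>
      ((\<lambda>e. (J Ar (\<lambda>t. Br t + e *\<^sub>R D t) Cr - J Ar Br Cr) / e) \<longlongrightarrow> 0) (at 0)"
    and t: "t \<in> {t0..tf}"
  shows "Qr t ** Br t = transpose (Y t) ** B t"
proof -
  let ?G = "\<lambda>t. Qr t ** Br t - transpose (Y t) ** B t"
  have "?G t = 0"
  proof (rule zero_of_integral_test_functions[OF t0_less_tf _ _ t])
    show "continuous_on {t0..tf} ?G" by (intro continuous_intros cont cont_gramians)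
    fix D :: "real \<Rightarrow> real^'m^'r" assume D: "continuous_on {t0..tf} D"
    let ?h = "\<lambda>t. Qr t \<bullet> (D t ** transpose (D t))"
    show "integral {t0..tf} (\<lambda>t. 2 * (D t \<bullet> ?G t)) = 0"
    proof (rule first_variation_zero_quadratic[OF stat[OF D], where h = ?h])
      fix e
      let ?B' = "\<lambda>t. Br t + e *\<^sub>R D t"
      have "\<exists>K. gramian t0 tf Ar Ar (\<lambda>t. ?B' t ** transpose (?B' t)) K"
        by (rule gramian_exists[OF t0_le_tf cont(4,4)]) (intro continuous_intros cont D)
      then obtain Pr' where Pr': "gramian t0 tf Ar Ar (\<lambda>t. ?B' t ** transpose (?B' t)) Pr'" ..
      have "\<exists>K. gramian t0 tf A Ar (\<lambda>t. B t ** transpose (?B' t)) K"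
        by (rule gramian_exists[OF t0_le_tf cont(1,4)]) (intro continuous_intros cont D)
      then obtain X' where X': "gramian t0 tf A Ar (\<lambda>t. B t ** transpose (?B' t)) X'" ..
      \<comment> \<open>The expansion of the change in the source term. The coefficients
        \<open>A\<close> and \<open>Ar\<close> are unchanged, so the perturbed gramians do not occur
        in the forcing.\<close>
      let ?F = "\<lambda>t. e *\<^sub>R (D t ** transpose (Br t) + Br t ** transpose (D t)) + (e * e) *\<^sub>R (D t ** transpose (D t))"
      let ?H = "\<lambda>t. e *\<^sub>R (B t ** transpose (D t))"
      have "J Ar ?B' Cr - J Ar Br Cr = integral {t0..tf} (\<lambda>t. Qr t \<bullet> ?F t - 2 * (Y t \<bullet> ?H t))"
      proof (rule J_variation_state_input[OF cont(4) _ _ Pr' X'])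
        show "gramian t0 tf Ar Ar ?F (\<lambda>t. Pr' t - Pr t)"
          by (rule gramian_diff[OF Pr' Pr]) (simp add: matrix_bilinear_simps algebra_simps)
        show "gramian t0 tf A Ar ?H (\<lambda>t. X' t - X t)"
          by (rule gramian_diff[OF X' X]) (simp add: matrix_bilinear_simps algebra_simps)
      qed (intro continuous_intros cont D)+
      also have "\<dots> = integral {t0..tf} (\<lambda>t. e * (2 * (D t \<bullet> ?G t) + e * ?h t))"
      proof (rule integral_cong)
        fix s assume s: "s \<in> {t0..tf}"
        have "Qr s \<bullet> (D s ** transpose (Br s)) = D s \<bullet> (Qr s ** Br s)"
          using inner_matrix_mul_mid[of "Qr s" "D s" "transpose (Br s)"] by simp
        moreover have "Qr s \<bullet> (Br s ** transpose (D s)) = D s \<bullet> (Qr s ** Br s)"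
          using inner_matrix_mul_transpose[of "Qr s" "Br s" "D s"] by (simp only: Qr_symmetric[OF s])
        moreover have "Y s \<bullet> (B s ** transpose (D s)) = D s \<bullet> (transpose (Y s) ** B s)"
          by (rule inner_matrix_mul_transpose)
        ultimately show "Qr s \<bullet> ?F s - 2 * (Y s \<bullet> ?H s) = e * (2 * (D s \<bullet> ?G s) + e * ?h s)"
          by (simp add: inner_add_right inner_diff_right algebra_simps)
      qed
      finally show "J Ar ?B' Cr - J Ar Br Cr = \<dots>" .
    qed (intro continuous_intros cont cont_gramians D)+
  qed
  then show ?thesis by simp
qed

text \<open>Here the coefficients themselves move, so the forcing retains the perturbed gramians
  \<open>Pe e\<close> and \<open>Xe e\<close>, and the quotient is no explicit polynomial in
  \<open>e\<close>.\<close>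

lemma stationary_state:
  assumes stat: "\<And>D. continuous_on {t0..tf} D \<Longrightarrow>
      ((\<lambda>e. (J (\<lambda>t. Ar t + e *\<^sub>R D t) Br Cr - J Ar Br Cr) / e) \<longlongrightarrow> 0) (at 0)"
    and t: "t \<in> {t0..tf}"
  shows "Qr t ** Pr t = transpose (Y t) ** X t"
proof -
  let ?G = "\<lambda>t. Qr t ** Pr t - transpose (Y t) ** X t"
  have "?G t = 0"
  proof (rule zero_of_integral_test_functions[OF t0_less_tf _ _ t])
    show "continuous_on {t0..tf} ?G" by (intro continuous_intros cont cont_gramians)
    fix D :: "real \<Rightarrow> real^'r^'r" assume D: "continuous_on {t0..tf} D"
    let ?A = "\<lambda>e t. Ar t + e *\<^sub>R D t"
    have A': "continuous_on {t0..tf} (?A e)" for e by (intro continuous_intros cont D)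
    have "\<forall>e. \<exists>K. gramian t0 tf (?A e) (?A e) (\<lambda>t. Br t ** transpose (Br t)) K"
      by (rule allI, rule gramian_exists[OF t0_le_tf A' A']) (intro continuous_intros cont)
    from choice[OF this]
    obtain Pe where "\<forall>e. gramian t0 tf (?A e) (?A e) (\<lambda>t. Br t ** transpose (Br t)) (Pe e)" ..
    then have Pe: "gramian t0 tf (?A e) (?A e) (\<lambda>t. Br t ** transpose (Br t)) (Pe e)" for e
      by (rule spec)
    have "\<forall>e. \<exists>K. gramian t0 tf A (?A e) (\<lambda>t. B t ** transpose (Br t)) K"
      by (rule allI, rule gramian_exists[OF t0_le_tf cont(1) A']) (intro continuous_intros cont)
    from choice[OF this]
    obtain Xe where "\<forall>e. gramian t0 tf A (?A e) (\<lambda>t. B t ** transpose (Br t)) (Xe e)" ..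
    then have Xe: "gramian t0 tf A (?A e) (\<lambda>t. B t ** transpose (Br t)) (Xe e)" for e
      by (rule spec)
    have limP: "uniform_limit {t0..tf} Pe Pr (at 0)"
      by (rule gramian_perturbation[OF t0_le_tf cont(4) D cont(4) D Pr Pe])
    \<comment> \<open>Only the right coefficient of the equation for \<open>X\<close> is perturbed;
      the left one gets direction 0.\<close>
    have limX: "uniform_limit {t0..tf} Xe X (at 0)"
      by (rule gramian_perturbation[OF t0_le_tf cont(1) continuous_on_const[of _ 0] cont(4) D X])
        (simp add: Xe)
    let ?s = "\<lambda>Pr X t. Qr t \<bullet> (D t ** Pr t + Pr t ** transpose (D t)) - 2 * (Y t \<bullet> (X t ** transpose (D t)))"
    have z: "integral {t0..tf} (?s Pr X) = 0"
    proof (rule first_variation_zero[OF stat[OF D]])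
      show "J (?A e) Br Cr - J Ar Br Cr = e * integral {t0..tf} (?s (Pe e) (Xe e))" for e
      proof -
        \<comment> \<open>With \<open>Pe e\<close> rather than \<open>Pr\<close> in the forcing no
          remainder of second order is left over.\<close>
        let ?F = "\<lambda>t. e *\<^sub>R (D t ** Pe e t + Pe e t ** transpose (D t))"
        let ?H = "\<lambda>t. e *\<^sub>R (Xe e t ** transpose (D t))"
        have "J (?A e) Br Cr - J Ar Br Cr = integral {t0..tf} (\<lambda>t. Qr t \<bullet> ?F t - 2 * (Y t \<bullet> ?H t))"
        proof (rule J_variation_state_input[OF A' _ _ Pe Xe])
          show "gramian t0 tf Ar Ar ?F (\<lambda>t. Pe e t - Pr t)"
            by (rule gramian_diff[OF Pe Pr]) (simp add: matrix_bilinear_simps algebra_simps)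
          show "gramian t0 tf A Ar ?H (\<lambda>t. Xe e t - X t)"
            by (rule gramian_diff[OF Xe X]) (simp add: matrix_bilinear_simps algebra_simps)
        qed (intro continuous_intros D gramian_continuous[OF Pe] gramian_continuous[OF Xe])+
        also have "\<dots> = integral {t0..tf} (\<lambda>t. e * ?s (Pe e) (Xe e) t)"
          by (simp add: algebra_simps)
        finally show ?thesis by simp
      qed
      \<comment> \<open>Products preserve uniform convergence when the limits are bounded, which
        continuity on the compact interval provides.\<close>
      have bdd: "bounded (F ` {t0..tf})" if "continuous_on {t0..tf} F"
        for F :: "real \<Rightarrow> 'x::real_normed_vector"
        by (rule compact_imp_bounded[OF compact_continuous_image[OF that compact_Icc]])
      have "uniform_limit {t0..tf} (\<lambda>e. ?s (Pe e) (Xe e)) (?s Pr X) (at 0)"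
        by (intro uniform_limit_intros mm.bounded_uniform_limit
            bounded_bilinear.bounded_uniform_limit[OF bounded_bilinear_inner]
            bounded_linear.uniform_limit[OF bounded_linear_mult_right]
            limP limX bdd continuous_intros cont cont_gramians D)
      then show "((\<lambda>e. integral {t0..tf} (?s (Pe e) (Xe e))) \<longlongrightarrow> integral {t0..tf} (?s Pr X)) (at 0)"
        by (rule tendsto_integral_uniform_limit)
          (intro continuous_intros cont cont_gramians D gramian_continuous[OF Pe]
            gramian_continuous[OF Xe] | simp)+
    qed
    have "?s Pr X s = 2 * (D s \<bullet> ?G s)" if s: "s \<in> {t0..tf}" for s
    proof -
      have "Qr s \<bullet> (D s ** Pr s) = D s \<bullet> (Qr s ** Pr s)"
        using inner_matrix_mul_mid[of "Qr s" "D s" "Pr s"] by (simp only: Pr_symmetric[OF s])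
      moreover have "Qr s \<bullet> (Pr s ** transpose (D s)) = D s \<bullet> (Qr s ** Pr s)"
        using inner_matrix_mul_transpose[of "Qr s" "Pr s" "D s"] by (simp only: Qr_symmetric[OF s])
      moreover have "Y s \<bullet> (X s ** transpose (D s)) = D s \<bullet> (transpose (Y s) ** X s)"
        by (rule inner_matrix_mul_transpose)
      ultimately show ?thesis by (simp add: inner_add_right inner_diff_right)
    qed
    then have "integral {t0..tf} (?s Pr X) = integral {t0..tf} (\<lambda>t. 2 * (D t \<bullet> ?G t))"
      by (rule integral_cong)
    with z show "integral {t0..tf} (\<lambda>t. 2 * (D t \<bullet> ?G t)) = 0" by simp
  qed
  then show ?thesis by simp
qed

end

text \<open>Invertibility is a premise at each single \<open>t\<close>: since
  \<open>Pr t0 = 0\<close> and \<open>Qr tf = 0\<close>, it cannot hold on all of the closed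
  interval. Differentiability is asserted as well, because \<open>vector_derivative\<close> is a
  choice and would otherwise say nothing.\<close>

theorem theorem7:
  fixes t0 tf :: real
    and A :: "real \<Rightarrow> real^'n^'n" and B :: "real \<Rightarrow> real^'m^'n" and C :: "real \<Rightarrow> real^'n^'p"
    and Ar :: "real \<Rightarrow> real^'r^'r" and Br :: "real \<Rightarrow> real^'m^'r" and Cr :: "real \<Rightarrow> real^'r^'p"
    and Pr Qr :: "real \<Rightarrow> real^'r^'r" and X Y :: "real \<Rightarrow> real^'r^'n"
    and Wr Vr :: "real \<Rightarrow> real^'r^'n"
  assumes "t0 < tf"
    and "CARD('r) < CARD('n)"
    and "continuous_on {t0..tf} A" "bounded (A ` {t0..tf})"
    and "continuous_on {t0..tf} B" "bounded (B ` {t0..tf})"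
    and "continuous_on {t0..tf} C" "bounded (C ` {t0..tf})"
    and "H2_stationary t0 tf A B C Ar Br Cr"
    and "\<And>t. t \<in> {t0..tf} \<Longrightarrow>
           (Pr has_vector_derivative
             (Ar t ** Pr t + Pr t ** transpose (Ar t) + Br t ** transpose (Br t)))
             (at t within {t0..tf})"
    and "Pr t0 = 0"
    and "\<And>t. t \<in> {t0..tf} \<Longrightarrow>
           (Qr has_vector_derivative
             - (transpose (Ar t) ** Qr t + Qr t ** Ar t + transpose (Cr t) ** Cr t))
             (at t within {t0..tf})"
    and "Qr tf = 0"
    and "\<And>t. t \<in> {t0..tf} \<Longrightarrow>
           (X has_vector_derivative
             (A t ** X t + X t ** transpose (Ar t) + B t ** transpose (Br t)))
             (at t within {t0..tf})"
    and "X t0 = 0"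
    and "\<And>t. t \<in> {t0..tf} \<Longrightarrow>
           (Y has_vector_derivative
             - (transpose (A t) ** Y t + Y t ** Ar t + transpose (C t) ** Cr t))
             (at t within {t0..tf})"
    and "Y tf = 0"
    and "\<And>t. t \<in> {t0..tf} \<Longrightarrow> Wr t = Y t ** matrix_inv (Qr t)"
    and "\<And>t. t \<in> {t0..tf} \<Longrightarrow> Vr t = X t ** matrix_inv (Pr t)"
  shows "\<forall>t\<in>{t0..tf}. invertible (Pr t) \<and> invertible (Qr t) \<longrightarrow>
           Vr differentiable (at t within {t0..tf}) \<and>
           (\<lambda>s. transpose (Wr s)) differentiable (at t within {t0..tf}) \<and>
           Ar t = transpose (Wr t) ** (A t ** Vr t - vector_derivative Vr (at t within {t0..tf})) \<and>
           Ar t = (transpose (Wr t) ** A t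
                   + vector_derivative (\<lambda>s. transpose (Wr s)) (at t within {t0..tf})) ** Vr t \<and>
           Br t = transpose (Wr t) ** B t \<and>
           Cr t = C t ** Vr t \<and>
           transpose (Wr t) ** Vr t = mat 1"
proof -
  have cont: "continuous_on {t0..tf} Ar" "continuous_on {t0..tf} Br" "continuous_on {t0..tf} Cr"
    using assms(9) unfolding H2_stationary_def by auto
  have le: "t0 \<le> tf" using assms(1) by simp
  have "\<exists>P. gramian t0 tf A A (\<lambda>t. B t ** transpose (B t)) P"
    by (rule gramian_exists[OF le assms(3,3)]) (intro continuous_intros assms(5))
  then obtain P where P: "gramian t0 tf A A (\<lambda>t. B t ** transpose (B t)) P" ..
  interpret reduced_model t0 tf A B C Ar Br Cr P Pr Qr X Y
    using assms(1,3,5,7,10-17) cont P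
    by unfold_locales (auto simp: gramian_def cogramian_def)
  have st: "Qr t ** Pr t = transpose (Y t) ** X t"
    and inp: "Qr t ** Br t = transpose (Y t) ** B t"
    and outp: "Cr t ** Pr t = C t ** X t" if t: "t \<in> {t0..tf}" for t
  proof -
    note stat = assms(9)[unfolded H2_stationary_def]
    show "Qr t ** Pr t = transpose (Y t) ** X t"
      by (rule stationary_state[OF _ t]) (use stat in blast)
    show "Qr t ** Br t = transpose (Y t) ** B t"
      by (rule stationary_input[OF _ t]) (use stat in blast)
    show "Cr t ** Pr t = C t ** X t"
      by (rule stationary_output[OF _ t]) (use stat in blast)
  qed
  show ?thesis
  proof (intro ballI impI)
    fix t assume t: "t \<in> {t0..tf}" and inv: "invertible (Pr t) \<and> invertible (Qr t)"
    define R where "R = matrix_inv (Pr t)"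
    define Z where "Z = matrix_inv (Qr t)"
    have R: "Pr t ** R = mat 1" "R ** Pr t = mat 1" and Z: "Qr t ** Z = mat 1" "Z ** Qr t = mat 1"
      using inv by (simp_all add: R_def Z_def matrix_inv_mult)
    \<comment> \<open>\<open>Qr s\<close> may be singular at other instants, so the transpose of its
      inverse is kept here; that the inverse is symmetric is used only at \<open>t\<close>.\<close>
    have W: "transpose (Wr s) = transpose (matrix_inv (Qr s)) ** transpose (Y s)"
      if "s \<in> {t0..tf}" for s
      using assms(18)[OF that] by (simp add: matrix_transpose_mul)
    have Zt: "transpose Z = Z"
    proof -
      have "Qr t ** transpose Z = mat 1"
        using arg_cong[OF Z(2), of transpose] by (simp add: matrix_transpose_mul Qr_symmetric[OF t])
      then have "Z ** (Qr t ** transpose Z) = Z" by simp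
      then show ?thesis using Z(2) by (simp add: matrix_mul_assoc)
    qed
    have Wt: "transpose (Wr t) = Z ** transpose (Y t)" using W[OF t] Zt by (simp add: Z_def)
    have Vt: "Vr t = X t ** R" using assms(19)[OF t] by (simp add: R_def)
    have YV: "transpose (Y t) ** Vr t = Qr t"
      using arg_cong[OF st[OF t], of "\<lambda>M. M ** R"] R(1)
      by (simp add: Vt flip: matrix_mul_assoc)
    have WX: "transpose (Wr t) ** X t = Pr t"
      using arg_cong[OF st[OF t], of "\<lambda>M. Z ** M"] Z(2)
      by (simp add: Wt matrix_mul_assoc)
    have WB: "transpose (Wr t) ** B t = Br t"
      using arg_cong[OF inp[OF t], of "\<lambda>M. Z ** M"] Z(2)
      by (simp add: Wt matrix_mul_assoc)
    have CV: "C t ** Vr t = Cr t"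
      using arg_cong[OF outp[OF t], of "\<lambda>M. M ** R"] R(1)
      by (simp add: Vt flip: matrix_mul_assoc)
    have WV: "transpose (Wr t) ** Vr t = mat 1"
      using WX R(1) by (simp add: Vt matrix_mul_assoc)
    define X' where "X' = A t ** X t + X t ** transpose (Ar t) + B t ** transpose (Br t)"
    define P' where "P' = Ar t ** Pr t + Pr t ** transpose (Ar t) + Br t ** transpose (Br t)"
    define V' where "V' = X' ** R - Vr t ** P' ** R"
    have dV: "(Vr has_vector_derivative V') (at t within {t0..tf})"
    proof (rule has_vector_derivative_transform[OF t assms(19)])
      show "((\<lambda>s. X s ** matrix_inv (Pr s)) has_vector_derivative V') (at t within {t0..tf})"
        using mm.has_vector_derivative[OF assms(14)[OF t]
            has_vector_derivative_matrix_inv[OF assms(10)[OF t] conjunct1[OF inv]]]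
        by (simp add: V'_def X'_def P'_def Vt R_def mm.minus_right matrix_mul_assoc)
    qed
    define Y' where "Y' = - (transpose (A t) ** Y t + Y t ** Ar t + transpose (C t) ** Cr t)"
    define Q' where "Q' = - (transpose (Ar t) ** Qr t + Qr t ** Ar t + transpose (Cr t) ** Cr t)"
    have dY: "(Y has_vector_derivative Y') (at t within {t0..tf})"
      and dQ: "(Qr has_vector_derivative Q') (at t within {t0..tf})"
      unfolding Y'_def Q'_def by (rule assms(16)[OF t], rule assms(12)[OF t])
    define W' where "W' = Z ** transpose Y' - Z ** transpose Q' ** transpose (Wr t)"
    have dW: "((\<lambda>s. transpose (Wr s)) has_vector_derivative W') (at t within {t0..tf})"
    proof (rule has_vector_derivative_transform[OF t W])
      show "((\<lambda>s. transpose (matrix_inv (Qr s)) ** transpose (Y s)) has_vector_derivative W')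
          (at t within {t0..tf})"
        using mm.has_vector_derivative[OF has_vector_derivative_transpose[OF
              has_vector_derivative_matrix_inv[OF dQ conjunct2[OF inv]]]
            has_vector_derivative_transpose[OF dY]]
        by (simp add: W'_def Z_def[symmetric] Wt
            matrix_transpose_mul transpose_minus Zt mm.minus_left matrix_mul_assoc)
    qed
    \<comment> \<open>By W^T X = P_r and W^T B = B_r the terms with \<open>transpose (Ar t)\<close>
      and \<open>transpose (Br t)\<close> in \<open>X'\<close> cancel those in \<open>P'\<close>,
      leaving W^T A V - A_r.\<close>
    have "transpose (Wr t) ** V' = transpose (Wr t) ** X' ** R - P' ** R"
      using WV by (simp add: V'_def mm.diff_right matrix_mul_assoc)
    also have "transpose (Wr t) ** X'
        = transpose (Wr t) ** A t ** X t + Pr t ** transpose (Ar t) + Br t ** transpose (Br t)"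
      using WX WB by (simp add: X'_def mm.add_right matrix_mul_assoc)
    also have "\<dots> ** R - P' ** R = transpose (Wr t) ** A t ** X t ** R - Ar t ** (Pr t ** R)"
      by (simp add: P'_def mm.add_left matrix_mul_assoc)
    finally have 1: "Ar t = transpose (Wr t) ** (A t ** Vr t - V')"
      using R(1) by (simp add: mm.diff_right Vt matrix_mul_assoc)
    \<comment> \<open>The mirror computation: by Y^T V = Q_r and C V = C_r the terms A_r^T Q_r and
      C_r^T C_r cancel, leaving A_r - W^T A V.\<close>
    have "W' ** Vr t = Z ** (transpose Y' ** Vr t) - Z ** transpose Q'"
      using WV by (simp add: W'_def mm.diff_left flip: matrix_mul_assoc)
    also have "transpose Y' ** Vr t = - (transpose (Y t) ** A t ** Vr t
        + transpose (Ar t) ** Qr t + transpose (Cr t) ** Cr t)"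
      unfolding Y'_def transpose_minus transpose_add matrix_transpose_mul transpose_transpose
        mm.minus_left mm.add_left
      using YV CV by (simp flip: matrix_mul_assoc)
    also have "transpose Q' = - (Qr t ** Ar t + transpose (Ar t) ** Qr t + transpose (Cr t) ** Cr t)"
      by (simp add: Q'_def transpose_minus transpose_add transpose_diff matrix_transpose_mul Qr_symmetric[OF t])
    also have "Z ** - (transpose (Y t) ** A t ** Vr t + transpose (Ar t) ** Qr t + transpose (Cr t) ** Cr t)
        - Z ** - (Qr t ** Ar t + transpose (Ar t) ** Qr t + transpose (Cr t) ** Cr t)
        = (Z ** Qr t) ** Ar t - transpose (Wr t) ** A t ** Vr t"
      by (simp add: Wt mm.minus_right mm.add_right mm.diff_right matrix_mul_assoc)
    finally have 2: "Ar t = (transpose (Wr t) ** A t + W') ** Vr t"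
      using Z(2) by (simp add: mm.add_left)
    \<comment> \<open>As \<open>t0 < tf\<close>, derivatives within the interval are unique, also at
      its end points.\<close>
    have "vector_derivative Vr (at t within {t0..tf}) = V'"
      "vector_derivative (\<lambda>s. transpose (Wr s)) (at t within {t0..tf}) = W'"
      using vector_derivative_within_closed_interval[OF assms(1) t] dV dW by auto
    with 1 2 WB CV WV show "Vr differentiable (at t within {t0..tf}) \<and>
           (\<lambda>s. transpose (Wr s)) differentiable (at t within {t0..tf}) \<and>
           Ar t = transpose (Wr t) ** (A t ** Vr t - vector_derivative Vr (at t within {t0..tf})) \<and>
           Ar t = (transpose (Wr t) ** A t
                   + vector_derivative (\<lambda>s. transpose (Wr s)) (at t within {t0..tf})) ** Vr t \<and>
           Br t = transpose (Wr t) ** B t \<and>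
           Cr t = C t ** Vr t \<and>
           transpose (Wr t) ** Vr t = mat 1"
      using differentiableI_vector[OF dV] differentiableI_vector[OF dW] by simp
  qed
qed

end
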